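(* Let $\Gamma$ be a small Coxeter graph that is spherical. Then $$A[\Gamma][2]=\ker\bigl(A[\Gamma]\to W[\Gamma]/Z(W[\Gamma])\bigr),$$ where the map is the composition of the natural projection $\pi:A[\Gamma]\to W[\Gamma]$ with the quotient by the center $Z(W[\Gamma])$ of $W[\Gamma]$.
   Context: A Coxeter matrix on $\{1,\dots,n\}$ is a symmetric matrix $(m_{i,j})$ with $m_{i,i}=1$ and $m_{i,j}\in\{2,3,\dots\}\cup\{\infty\}$ for $i\ne j$. Its Coxeter graph $\Gamma$ has vertices $1,\dots,n$, with $i,j$ joined by an edge when $m_{i,j}\ge 3$ (including $\infty$). $\Gamma$ is small if every $m_{i,j}\in\{1,2,3,\infty\}$. The Coxeter group is $W[\Gamma]=\langle w_1,\dots,w_n\mid (w_iw_j)^{m_{i,j}}=1,\ m_{i,j}<\infty\rangle$ and the Artin group is $A[\Gamma]=\langle a_1,\dots,a_n \mid \underbrace{a_ia_ja_i\cdots}_{m_{i,j}}=\underbrace{a_ja_ia_j\cdots}_{m_{i,j}} \text{ for } i\neq j,\ m_{i,j}<\infty\rangle$; $\pi:A[\Gamma]\to W[\Gamma]$ sends $a_i\mapsto w_i$. $\Gamma$ is spherical if $W[\Gamma]$ is finite. For small $\Gamma$, the integral generalised Burau representation $\tilde\sigma:A[\Gamma]\to\mathrm{GL}(n,\mathbb{Z})$ is defined on the basis $e_1,\dots,e_n$ by $\tilde\sigma(a_i)(e_j)=e_j-\langle e_i,e_j\rangle e_i$, where $\langle e_i,e_j\rangle=-2\cos(\pi/m_{i,j})$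 if $i<j$, $0$ if $i=j$, and $2\cos(\pi/m_{i,j})$ if $i>j$, with the convention $\pi/\infty=0$. $A[\Gamma][2]$ is the kernel of $A[\Gamma]\xrightarrow{\tilde\sigma}\mathrm{GL}(n,\mathbb{Z})\to\mathrm{GL}(n,\mathbb{Z}/2)$. *)

theory Defs
  imports
    Complex_Main
    "HOL-Library.Extended_Nat"
    "HOL-Library.Z2"
    "HOL-Algebra.Coset"
    "Jordan_Normal_Form.Matrix"
begin

section \<open>Groups given by generators and relations\<close>

text \<open>A letter \<open>(x, True)\<close> stands for the generator \<open>x\<close>, and \<open>(x, False)\<close> for its formal inverse.\<close>

type_synonym 'a gword = "('a \<times> bool) list"

definition gwords :: "'a set \<Rightarrow> 'a gword set" where
  "gwords S = lists (S \<times> UNIV)"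

text \<open>The congruence on words generated by free cancellation and the relations \<open>u = v\<close> with
  \<open>(u, v) \<in> R\<close>.\<close>

inductive pres_eq :: "'a set \<Rightarrow> ('a gword \<times> 'a gword) set \<Rightarrow> 'a gword \<Rightarrow> 'a gword \<Rightarrow> bool"
  for S :: "'a set" and R :: "('a gword \<times> 'a gword) set" where
  refl: "u \<in> gwords S \<Longrightarrow> pres_eq S R u u"
| sym: "pres_eq S R u v \<Longrightarrow> pres_eq S R v u"
| trans: "pres_eq S R u v \<Longrightarrow> pres_eq S R v w \<Longrightarrow> pres_eq S R u w"
| append: "pres_eq S R u u' \<Longrightarrow> pres_eq S R v v' \<Longrightarrow> pres_eq S R (u @ v) (u' @ v')"
| cancel: "x \<in> S \<Longrightarrow> pres_eq S R [(x, b), (x, \<not> b)] []"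
| relation: "(u, v) \<in> R \<Longrightarrow> u \<in> gwords S \<Longrightarrow> v \<in> gwords S \<Longrightarrow> pres_eq S R u v"

definition pres_rel :: "'a set \<Rightarrow> ('a gword \<times> 'a gword) set \<Rightarrow> ('a gword \<times> 'a gword) set" where
  "pres_rel S R = {(u, v). pres_eq S R u v}"

definition pres_group :: "'a set \<Rightarrow> ('a gword \<times> 'a gword) set \<Rightarrow> 'a gword set monoid" where
  "pres_group S R =
    \<lparr>carrier = gwords S // pres_rel S R,
     monoid.mult = (\<lambda>X Y. \<Union>u\<in>X. \<Union>v\<in>Y. pres_rel S R `` {u @ v}),
     one = pres_rel S R `` {[]}\<rparr>"

definition pres_gen :: "'a set \<Rightarrow> ('a gword \<times> 'a gword) set \<Rightarrow> 'a \<Rightarrow> 'a gword set" where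
  "pres_gen S R x = pres_rel S R `` {[(x, True)]}"

definition letter_value :: "('g, 'z) monoid_scheme \<Rightarrow> ('a \<Rightarrow> 'g) \<Rightarrow> 'a \<times> bool \<Rightarrow> 'g" where
  "letter_value G f = (\<lambda>(x, b). if b then f x else inv\<^bsub>G\<^esub> f x)"

primrec word_value :: "('g, 'z) monoid_scheme \<Rightarrow> ('a \<Rightarrow> 'g) \<Rightarrow> 'a gword \<Rightarrow> 'g" where
  "word_value G f [] = \<one>\<^bsub>G\<^esub>"
| "word_value G f (a # w) = letter_value G f a \<otimes>\<^bsub>G\<^esub> word_value G f w"

text \<open>The homomorphism from a presented group to \<open>G\<close> determined by the images \<open>f x\<close> of the
  generators. It is meaningful when these images satisfy the defining relations; see
  \<open>pres_lift_hom\<close>, \<open>pres_lift_gen\<close> and \<open>pres_lift_unique\<close> below.\<close>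

definition pres_lift :: "('g, 'z) monoid_scheme \<Rightarrow> ('a \<Rightarrow> 'g) \<Rightarrow> 'a gword set \<Rightarrow> 'g" where
  "pres_lift G f X = the_elem (word_value G f ` X)"

lemma gwords_simps [simp]:
  "[] \<in> gwords S"
  "a # w \<in> gwords S \<longleftrightarrow> fst a \<in> S \<and> w \<in> gwords S"
  "u @ v \<in> gwords S \<longleftrightarrow> u \<in> gwords S \<and> v \<in> gwords S"
  by (cases a; auto simp: gwords_def)+

lemma pres_eq_gwords: "pres_eq S R u v \<Longrightarrow> u \<in> gwords S \<and> v \<in> gwords S"
  by (induction rule: pres_eq.induct) auto

lemma equiv_pres_rel: "equiv (gwords S) (pres_rel S R)"
proof (rule equivI)
  show "pres_rel S R \<subseteq> gwords S \<times> gwords S"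
    by (auto simp: pres_rel_def dest: pres_eq_gwords)
  show "refl_on (gwords S) (pres_rel S R)"
    by (auto simp: refl_on_def pres_rel_def intro: pres_eq.refl)
  show "sym (pres_rel S R)"
    by (auto simp: sym_def pres_rel_def intro: pres_eq.sym)
  show "trans (pres_rel S R)"
    by (auto simp: trans_def pres_rel_def intro: pres_eq.trans)
qed

lemma pres_class_eq_iff:
  assumes "u \<in> gwords S" "v \<in> gwords S"
  shows "pres_rel S R `` {u} = pres_rel S R `` {v} \<longleftrightarrow> pres_eq S R u v"
  using eq_equiv_class_iff[OF equiv_pres_rel assms] by (simp add: pres_rel_def)

lemma pres_group_carrierE:
  assumes "X \<in> carrier (pres_group S R)"
  obtains u where "u \<in> gwords S" "X = pres_rel S R `` {u}"
  using assms by (auto simp: pres_group_def elim: quotientE)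

lemma pres_class_carrier: "u \<in> gwords S \<Longrightarrow> pres_rel S R `` {u} \<in> carrier (pres_group S R)"
  by (auto simp: pres_group_def intro: quotientI)

lemma pres_group_mult:
  assumes "u \<in> gwords S" "v \<in> gwords S"
  shows "pres_rel S R `` {u} \<otimes>\<^bsub>pres_group S R\<^esub> pres_rel S R `` {v} = pres_rel S R `` {u @ v}"
proof -
  have *: "pres_rel S R `` {u' @ v'} = pres_rel S R `` {u @ v}"
    if "u' \<in> pres_rel S R `` {u}" "v' \<in> pres_rel S R `` {v}" for u' v'
  proof -
    have e: "pres_eq S R u u'" "pres_eq S R v v'" using that by (auto simp: pres_rel_def)
    have "pres_eq S R (u @ v) (u' @ v')" using e by (rule pres_eq.append)
    moreover have "u' @ v' \<in> gwords S" "u @ v \<in> gwords S"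
      using e[THEN pres_eq_gwords] by auto
    ultimately show ?thesis by (simp add: pres_class_eq_iff pres_eq.sym)
  qed
  have "u \<in> pres_rel S R `` {u}" "v \<in> pres_rel S R `` {v}"
    using assms by (auto simp: pres_rel_def intro: pres_eq.refl)
  then have "(\<Union>u'\<in>pres_rel S R `` {u}. \<Union>v'\<in>pres_rel S R `` {v}. pres_rel S R `` {u' @ v'})
      = pres_rel S R `` {u @ v}"
    using * by blast
  then show ?thesis by (simp add: pres_group_def)
qed

lemma pres_group_one: "\<one>\<^bsub>pres_group S R\<^esub> = pres_rel S R `` {[]}"
  by (simp add: pres_group_def)

lemma pres_left_inverse:
  "u \<in> gwords S \<Longrightarrow> \<exists>v \<in> gwords S. pres_eq S R (v @ u) []"
proof (induction u)
  case Nil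
  then show ?case by (intro bexI[of _ "[]"]) (auto intro: pres_eq.refl)
next
  case (Cons a u)
  then obtain v where v: "v \<in> gwords S" "pres_eq S R (v @ u) []" by auto
  obtain x b where a: "a = (x, b)" by (cases a)
  have x: "x \<in> S" and u: "u \<in> gwords S" using Cons.prems a by auto
  have "pres_eq S R [(x, \<not> b), (x, b)] []"
    using pres_eq.cancel[OF x, of R "\<not> b"] by simp
  then have "pres_eq S R (v @ ([(x, \<not> b), (x, b)] @ u)) (v @ ([] @ u))"
    using u v by (intro pres_eq.append pres_eq.refl)
  then have "pres_eq S R ((v @ [(x, \<not> b)]) @ a # u) []"
    using v(2) a by (auto intro: pres_eq.trans)
  moreover have "v @ [(x, \<not> b)] \<in> gwords S" using v x by auto
  ultimately show ?case by blast
qed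

lemma group_pres_group: "group (pres_group S R)"
proof (rule groupI)
  let ?G = "pres_group S R"
  show "\<one>\<^bsub>?G\<^esub> \<in> carrier ?G" by (simp add: pres_group_one pres_class_carrier)
  fix X assume "X \<in> carrier ?G"
  then obtain u where u: "u \<in> gwords S" "X = pres_rel S R `` {u}" by (rule pres_group_carrierE)
  show "\<one>\<^bsub>?G\<^esub> \<otimes>\<^bsub>?G\<^esub> X = X" using u by (simp add: pres_group_one pres_group_mult)
  obtain v where "v \<in> gwords S" "pres_eq S R (v @ u) []" using pres_left_inverse u by blast
  then show "\<exists>Y\<in>carrier ?G. Y \<otimes>\<^bsub>?G\<^esub> X = \<one>\<^bsub>?G\<^esub>"
    using u by (intro bexI[of _ "pres_rel S R `` {v}"])
      (auto simp: pres_group_one pres_group_mult pres_class_eq_iff pres_class_carrier)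
  fix Y assume "Y \<in> carrier ?G"
  then obtain v where v: "v \<in> gwords S" "Y = pres_rel S R `` {v}" by (rule pres_group_carrierE)
  show "X \<otimes>\<^bsub>?G\<^esub> Y \<in> carrier ?G" using u v by (simp add: pres_group_mult pres_class_carrier)
  fix Z assume "Z \<in> carrier ?G"
  then obtain w where w: "w \<in> gwords S" "Z = pres_rel S R `` {w}" by (rule pres_group_carrierE)
  show "(X \<otimes>\<^bsub>?G\<^esub> Y) \<otimes>\<^bsub>?G\<^esub> Z = X \<otimes>\<^bsub>?G\<^esub> (Y \<otimes>\<^bsub>?G\<^esub> Z)"
    using u v w by (simp add: pres_group_mult)
qed

context
  fixes G :: "('g, 'z) monoid_scheme" and S :: "'a set" and R :: "('a gword \<times> 'a gword) set"
    and f :: "'a \<Rightarrow> 'g"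
  assumes G: "group G"
    and f: "\<And>x. x \<in> S \<Longrightarrow> f x \<in> carrier G"
begin

interpretation G: group G by (rule G)

lemma letter_value_closed: "fst a \<in> S \<Longrightarrow> letter_value G f a \<in> carrier G"
  by (cases a) (auto simp: letter_value_def f)

lemma word_value_closed: "w \<in> gwords S \<Longrightarrow> word_value G f w \<in> carrier G"
  by (induction w) (auto simp: letter_value_closed)

lemma word_value_append:
  "u \<in> gwords S \<Longrightarrow> v \<in> gwords S \<Longrightarrow>
    word_value G f (u @ v) = word_value G f u \<otimes>\<^bsub>G\<^esub> word_value G f v"
  by (induction u) (auto simp: letter_value_closed word_value_closed G.m_assoc)

context
  assumes R: "\<And>u v. (u, v) \<in> R \<Longrightarrow> u \<in> gwords S \<Longrightarrow> v \<in> gwords S \<Longrightarrow>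
    word_value G f u = word_value G f v"
begin

lemma word_value_pres_eq: "pres_eq S R u v \<Longrightarrow> word_value G f u = word_value G f v"
proof (induction rule: pres_eq.induct)
  case (append u u' v v')
  then show ?case by (simp add: word_value_append pres_eq_gwords)
next
  case (cancel x b)
  then show ?case by (auto simp: letter_value_def f)
next
  case (relation u v)
  then show ?case by (rule R)
qed simp_all

lemma pres_lift_class:
  assumes "u \<in> gwords S"
  shows "pres_lift G f (pres_rel S R `` {u}) = word_value G f u"
proof -
  have "word_value G f v = word_value G f u" if "v \<in> pres_rel S R `` {u}" for v
    using word_value_pres_eq[of u v] that by (simp add: pres_rel_def)
  moreover have "u \<in> pres_rel S R `` {u}"
    using assms by (simp add: pres_rel_def pres_eq.refl)
  ultimately have "word_value G f ` (pres_rel S R `` {u}) = {word_value G f u}" by blast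
  then show ?thesis by (simp add: pres_lift_def)
qed

lemma pres_lift_hom: "pres_lift G f \<in> hom (pres_group S R) G"
proof (rule homI)
  fix X assume "X \<in> carrier (pres_group S R)"
  then obtain u where u: "u \<in> gwords S" "X = pres_rel S R `` {u}" by (rule pres_group_carrierE)
  show "pres_lift G f X \<in> carrier G" using u by (simp add: pres_lift_class word_value_closed)
  fix Y assume "Y \<in> carrier (pres_group S R)"
  then obtain v where v: "v \<in> gwords S" "Y = pres_rel S R `` {v}" by (rule pres_group_carrierE)
  show "pres_lift G f (X \<otimes>\<^bsub>pres_group S R\<^esub> Y) = pres_lift G f X \<otimes>\<^bsub>G\<^esub> pres_lift G f Y"
    using u v by (simp add: pres_group_mult pres_lift_class word_value_append)
qed

lemma pres_lift_gen: "x \<in> S \<Longrightarrow> pres_lift G f (pres_gen S R x) = f x"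
  by (simp add: pres_gen_def pres_lift_class letter_value_def f)

lemma pres_lift_unique:
  assumes h: "h \<in> hom (pres_group S R) G" "\<And>x. x \<in> S \<Longrightarrow> h (pres_gen S R x) = f x"
    and X: "X \<in> carrier (pres_group S R)"
  shows "h X = pres_lift G f X"
proof -
  interpret P: group "pres_group S R" by (rule group_pres_group)
  interpret h: group_hom "pres_group S R" G h
    by (simp add: group_hom_def group_hom_axioms_def P.group_axioms G h(1))
  have letter: "h (pres_rel S R `` {[a]}) = letter_value G f a" if "fst a \<in> S" for a
  proof -
    obtain x b where a: "a = (x, b)" by (cases a)
    have x: "x \<in> S" using that a by simp
    have g: "pres_gen S R x \<in> carrier (pres_group S R)"
      using x by (simp add: pres_gen_def pres_class_carrier)
    show ?thesis
    proof (cases b)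
      case True
      then show ?thesis using h(2)[OF x] a by (simp add: pres_gen_def letter_value_def)
    next
      case False
      have "pres_rel S R `` {[(x, False)]} \<otimes>\<^bsub>pres_group S R\<^esub> pres_gen S R x = \<one>\<^bsub>pres_group S R\<^esub>"
        using x pres_eq.cancel[OF x, of R False]
        by (simp add: pres_gen_def pres_group_mult pres_group_one pres_class_eq_iff)
      then have "pres_rel S R `` {[(x, False)]} = inv\<^bsub>pres_group S R\<^esub> pres_gen S R x"
        using g x by (intro P.inv_equality[symmetric]) (auto intro: pres_class_carrier)
      then show ?thesis using a False g h(2)[OF x] by (simp add: letter_value_def)
    qed
  qed
  have "h (pres_rel S R `` {u}) = word_value G f u" if "u \<in> gwords S" for u
    using that
  proof (induction u)
    case Nil
    then show ?case using h.hom_one by (simp add: pres_group_one)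
  next
    case (Cons a u)
    have "pres_rel S R `` {a # u}
        = pres_rel S R `` {[a]} \<otimes>\<^bsub>pres_group S R\<^esub> pres_rel S R `` {u}"
      using Cons.prems by (simp add: pres_group_mult)
    then show ?case using Cons letter[of a] by (simp add: pres_class_carrier)
  qed
  moreover obtain u where "u \<in> gwords S" "X = pres_rel S R `` {u}"
    using X by (rule pres_group_carrierE)
  ultimately show ?thesis by (simp add: pres_lift_class)
qed

end
end

definition center :: "('g, 'z) monoid_scheme \<Rightarrow> 'g set" where
  "center G = {z \<in> carrier G. \<forall>x \<in> carrier G. z \<otimes>\<^bsub>G\<^esub> x = x \<otimes>\<^bsub>G\<^esub> z}"

lemma center_normal:
  fixes G (structure)
  assumes "group G"
  shows "center G \<lhd> G"
proof -
  interpret group G by fact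
  have "subgroup (center G) G"
  proof
    show "center G \<subseteq> carrier G" "\<one> \<in> center G" by (auto simp: center_def)
  next
    fix x y assume *: "x \<in> center G" "y \<in> center G"
    then have xy: "x \<in> carrier G" "y \<in> carrier G" by (auto simp: center_def)
    have "x \<otimes> y \<otimes> z = z \<otimes> (x \<otimes> y)" if z: "z \<in> carrier G" for z
    proof -
      have c: "y \<otimes> z = z \<otimes> y" "x \<otimes> z = z \<otimes> x" using * z by (auto simp: center_def)
      have "x \<otimes> y \<otimes> z = x \<otimes> (z \<otimes> y)" unfolding c(1)[symmetric] using xy z by (rule m_assoc)
      also have "\<dots> = x \<otimes> z \<otimes> y" using xy z by (simp only: m_assoc)
      also have "\<dots> = z \<otimes> (x \<otimes> y)" unfolding c(2) using xy z by (simp only: m_assoc)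
      finally show ?thesis .
    qed
    then show "x \<otimes> y \<in> center G" using xy by (auto simp: center_def)
  next
    fix x assume *: "x \<in> center G"
    then have x: "x \<in> carrier G" by (auto simp: center_def)
    have "inv x \<otimes> z = z \<otimes> inv x" if z: "z \<in> carrier G" for z
    proof -
      have "inv x \<otimes> z = inv x \<otimes> (z \<otimes> x \<otimes> inv x)" using x z by (simp add: m_assoc)
      also have "z \<otimes> x = x \<otimes> z" using * z by (auto simp: center_def)
      also have "inv x \<otimes> (x \<otimes> z \<otimes> inv x) = z \<otimes> inv x"
        using x z by (simp add: m_assoc[symmetric])
      finally show ?thesis .
    qed
    then show "inv x \<in> center G" using x by (auto simp: center_def)
  qed
  moreover have "x \<otimes> h \<otimes> inv x \<in> center G" if "x \<in> carrier G" "h \<in> center G" for x h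
  proof -
    have h: "h \<in> carrier G" "x \<otimes> h = h \<otimes> x" using that by (auto simp: center_def)
    then have "x \<otimes> h \<otimes> inv x = h" using that by (simp add: m_assoc)
    then show ?thesis using that by simp
  qed
  ultimately show ?thesis by (simp add: normal_inv_iff)
qed

section \<open>Coxeter and Artin groups\<close>

text \<open>Vertices are indexed by \<open>{0, \<dots>, n - 1}\<close> rather than \<open>{1, \<dots>, n}\<close>, in line with matrix
  indices. A (labelled) Coxeter graph is represented by its Coxeter matrix \<open>m\<close>; the values of \<open>m\<close>
  outside the index range are never used.\<close>

definition coxeter_matrix :: "nat \<Rightarrow> (nat \<Rightarrow> nat \<Rightarrow> enat) \<Rightarrow> bool" where
  "coxeter_matrix n m \<longleftrightarrow>
    (\<forall>i<n. m i i = 1) \<and>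
    (\<forall>i<n. \<forall>j<n. m i j = m j i) \<and>
    (\<forall>i<n. \<forall>j<n. i \<noteq> j \<longrightarrow> m i j \<ge> 2)"

definition small :: "nat \<Rightarrow> (nat \<Rightarrow> nat \<Rightarrow> enat) \<Rightarrow> bool" where
  "small n m \<longleftrightarrow> (\<forall>i<n. \<forall>j<n. m i j \<in> {1, 2, 3, \<infinity>})"

definition coxeter_relations ::
  "nat \<Rightarrow> (nat \<Rightarrow> nat \<Rightarrow> enat) \<Rightarrow> (nat gword \<times> nat gword) set" where
  "coxeter_relations n m =
    {(concat (replicate k [(i, True), (j, True)]), []) | i j k.
      i < n \<and> j < n \<and> m i j = enat k}"

definition coxeter_group :: "nat \<Rightarrow> (nat \<Rightarrow> nat \<Rightarrow> enat) \<Rightarrow> nat gword set monoid" where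
  "coxeter_group n m = pres_group {..<n} (coxeter_relations n m)"

definition coxeter_gen :: "nat \<Rightarrow> (nat \<Rightarrow> nat \<Rightarrow> enat) \<Rightarrow> nat \<Rightarrow> nat gword set" where
  "coxeter_gen n m i = pres_gen {..<n} (coxeter_relations n m) i"

definition spherical :: "nat \<Rightarrow> (nat \<Rightarrow> nat \<Rightarrow> enat) \<Rightarrow> bool" where
  "spherical n m \<longleftrightarrow> finite (carrier (coxeter_group n m))"

text \<open>\<open>alt_word k x y\<close> is \<open>xyx\<cdots>\<close> with \<open>k\<close> letters.\<close>

primrec alt_word :: "nat \<Rightarrow> 'a \<Rightarrow> 'a \<Rightarrow> 'a gword" where
  "alt_word 0 x y = []"
| "alt_word (Suc k) x y = (x, True) # alt_word k y x"

definition artin_relations ::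
  "nat \<Rightarrow> (nat \<Rightarrow> nat \<Rightarrow> enat) \<Rightarrow> (nat gword \<times> nat gword) set" where
  "artin_relations n m =
    {(alt_word k i j, alt_word k j i) | i j k. i < n \<and> j < n \<and> i \<noteq> j \<and> m i j = enat k}"

definition artin_group :: "nat \<Rightarrow> (nat \<Rightarrow> nat \<Rightarrow> enat) \<Rightarrow> nat gword set monoid" where
  "artin_group n m = pres_group {..<n} (artin_relations n m)"

definition artin_gen :: "nat \<Rightarrow> (nat \<Rightarrow> nat \<Rightarrow> enat) \<Rightarrow> nat \<Rightarrow> nat gword set" where
  "artin_gen n m i = pres_gen {..<n} (artin_relations n m) i"

definition artin_proj :: "nat \<Rightarrow> (nat \<Rightarrow> nat \<Rightarrow> enat) \<Rightarrow> nat gword set \<Rightarrow> nat gword set" where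
  "artin_proj n m = pres_lift (coxeter_group n m) (coxeter_gen n m)"

lemma word_value_pres_gen:
  "u \<in> gwords S \<Longrightarrow> word_value (pres_group S R) (pres_gen S R) u = pres_rel S R `` {u}"
proof (induction u)
  case Nil
  then show ?case by (simp add: pres_group_one)
next
  case (Cons a u)
  interpret P: group "pres_group S R" by (rule group_pres_group)
  obtain x b where a: "a = (x, b)" by (cases a)
  have x: "x \<in> S" using Cons.prems a by simp
  have "letter_value (pres_group S R) (pres_gen S R) a = pres_rel S R `` {[a]}"
  proof (cases b)
    case True
    then show ?thesis using a by (simp add: letter_value_def pres_gen_def)
  next
    case False
    have "pres_rel S R `` {[(x, False)]} \<otimes>\<^bsub>pres_group S R\<^esub> pres_gen S R x = \<one>\<^bsub>pres_group S R\<^esub>"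
      using x pres_eq.cancel[OF x, of R False]
      by (simp add: pres_gen_def pres_group_mult pres_group_one pres_class_eq_iff)
    then have "inv\<^bsub>pres_group S R\<^esub> pres_gen S R x = pres_rel S R `` {[(x, False)]}"
      using x by (intro P.inv_equality) (auto simp: pres_gen_def intro: pres_class_carrier)
    then show ?thesis using a False by (simp add: letter_value_def)
  qed
  then show ?case using Cons by (simp add: pres_group_mult)
qed

lemma alt_word_gwords: "x \<in> S \<Longrightarrow> y \<in> S \<Longrightarrow> alt_word k x y \<in> gwords S"
  by (induction k arbitrary: x y) auto

lemma (in group) alt_word_involutions:
  assumes "f x \<in> carrier G" "f y \<in> carrier G" "f x \<otimes> f x = \<one>" "f y \<otimes> f y = \<one>"
  shows "word_value G f (alt_word k x y) \<otimes> inv (word_value G f (alt_word k y x)) =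
    (f x \<otimes> f y) [^] k"
  using assms
proof (induction k arbitrary: x y)
  case (Suc k)
  let ?s = "f x" and ?t = "f y"
  note c = Suc.prems(1,2)
  have w: "word_value G f (alt_word k x y) \<in> carrier G" "word_value G f (alt_word k y x) \<in> carrier G"
    using c by (auto intro!: word_value_closed[where S = "{x, y}"] alt_word_gwords group_axioms)
  have inv: "inv ?t = ?t" using Suc.prems by (intro inv_equality)
  have pow: "?s \<otimes> (?t \<otimes> ?s) [^] j \<otimes> ?t = (?s \<otimes> ?t) [^] Suc j" for j
  proof (induction j)
    case (Suc j)
    have "?s \<otimes> (?t \<otimes> ?s) [^] Suc j \<otimes> ?t = (?s \<otimes> (?t \<otimes> ?s) [^] j \<otimes> ?t) \<otimes> (?s \<otimes> ?t)"
      using c by (simp add: m_assoc)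
    then show ?case using Suc by simp
  qed (use c in simp)
  have "word_value G f (alt_word (Suc k) x y) \<otimes> inv (word_value G f (alt_word (Suc k) y x)) =
      ?s \<otimes> (word_value G f (alt_word k y x) \<otimes> inv (word_value G f (alt_word k x y))) \<otimes> ?t"
    using w c inv by (simp add: letter_value_def inv_mult_group m_assoc)
  also have "\<dots> = ?s \<otimes> (?t \<otimes> ?s) [^] k \<otimes> ?t"
    using Suc.IH[of y x] Suc.prems by simp
  finally show ?case using pow by simp
qed simp

lemma coxeter_gen_relations:
  assumes cox: "coxeter_matrix n m" and uv: "(u, v) \<in> artin_relations n m"
  shows "word_value (coxeter_group n m) (coxeter_gen n m) u =
    word_value (coxeter_group n m) (coxeter_gen n m) v"
proof -
  let ?W = "coxeter_group n m" and ?w = "coxeter_gen n m"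
  interpret W: group ?W unfolding coxeter_group_def by (rule group_pres_group)
  have gen: "?w i \<in> carrier ?W" if "i < n" for i
    using that by (auto simp: coxeter_group_def coxeter_gen_def pres_gen_def intro: pres_class_carrier)
  have pow: "(?w i \<otimes>\<^bsub>?W\<^esub> ?w j) [^]\<^bsub>?W\<^esub> k = \<one>\<^bsub>?W\<^esub>"
    if "i < n" "j < n" "m i j = enat k" for i j k
  proof -
    let ?c = "\<lambda>k. concat (replicate k [(i, True), (j, True)])"
    have words: "?c l \<in> gwords {..<n}" for l using that by (induction l) auto
    have "(?w i \<otimes>\<^bsub>?W\<^esub> ?w j) [^]\<^bsub>?W\<^esub> l = word_value ?W ?w (?c l)" for l
    proof (induction l)
      case (Suc l)
      have cl: "word_value ?W ?w (?c l) \<in> carrier ?W"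
        by (rule word_value_closed[OF W.group_axioms _ words]) (simp add: gen)
      have "(?w i \<otimes>\<^bsub>?W\<^esub> ?w j) [^]\<^bsub>?W\<^esub> Suc l =
          (?w i \<otimes>\<^bsub>?W\<^esub> ?w j) \<otimes>\<^bsub>?W\<^esub> (?w i \<otimes>\<^bsub>?W\<^esub> ?w j) [^]\<^bsub>?W\<^esub> l"
        using gen that by (intro W.nat_pow_Suc2) simp
      then show ?case using Suc cl gen that by (simp add: letter_value_def W.m_assoc)
    qed simp
    moreover have "word_value ?W ?w (?c k) = pres_rel {..<n} (coxeter_relations n m) `` {?c k}"
      unfolding coxeter_group_def coxeter_gen_def using words[of k] by (rule word_value_pres_gen)
    moreover have "pres_eq {..<n} (coxeter_relations n m) (?c k) []"
      using that words by (intro pres_eq.relation) (auto simp: coxeter_relations_def)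
    ultimately show ?thesis using words[of k]
      by (simp add: coxeter_group_def pres_group_one pres_class_eq_iff)
  qed
  have sq: "?w i \<otimes>\<^bsub>?W\<^esub> ?w i = \<one>\<^bsub>?W\<^esub>" if "i < n" for i
    using pow[of i i 1] cox that gen by (simp add: coxeter_matrix_def one_enat_def)
  obtain i j k where u: "u = alt_word k i j" and v: "v = alt_word k j i"
    and ij: "i < n" "j < n" and k: "m i j = enat k"
    using uv by (auto simp: artin_relations_def)
  have c: "word_value ?W ?w u \<in> carrier ?W" "word_value ?W ?w v \<in> carrier ?W"
    unfolding u v using ij
    by (auto intro!: word_value_closed[where S = "{..<n}"] alt_word_gwords W.group_axioms gen)
  have "word_value ?W ?w u \<otimes>\<^bsub>?W\<^esub> inv\<^bsub>?W\<^esub> word_value ?W ?w v = \<one>\<^bsub>?W\<^esub>"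
    unfolding u v using W.alt_word_involutions[of ?w i j k] pow[OF ij k] gen ij sq by simp
  then show ?thesis using c by (metis W.inv_closed W.inv_equality W.inv_inv)
qed

lemma artin_proj_hom:
  assumes "coxeter_matrix n m"
  shows "artin_proj n m \<in> hom (artin_group n m) (coxeter_group n m)"
  unfolding artin_proj_def artin_group_def
  using assms by (intro pres_lift_hom coxeter_gen_relations)
    (auto simp: coxeter_group_def coxeter_gen_def pres_gen_def
      intro: group_pres_group pres_class_carrier)

lemma artin_proj_gen:
  assumes "coxeter_matrix n m" "i < n"
  shows "artin_proj n m (artin_gen n m i) = coxeter_gen n m i"
  unfolding artin_proj_def artin_gen_def
  using assms by (intro pres_lift_gen coxeter_gen_relations)
    (auto simp: coxeter_group_def coxeter_gen_def pres_gen_def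
      intro: group_pres_group pres_class_carrier)

section \<open>The integral generalised Burau representation\<close>

fun cos_pi_over :: "enat \<Rightarrow> real" where
  "cos_pi_over (enat k) = cos (pi / real k)"
| "cos_pi_over \<infinity> = cos 0"

definition bracket :: "(nat \<Rightarrow> nat \<Rightarrow> enat) \<Rightarrow> nat \<Rightarrow> nat \<Rightarrow> real" where
  "bracket m i j =
    (if i < j then - 2 * cos_pi_over (m i j)
     else if i = j then 0
     else 2 * cos_pi_over (m i j))"

text \<open>For small graphs the brackets are integers (\<open>bracket_integral\<close> below), so the floor only
  performs the change of type.\<close>

definition bracket_int :: "(nat \<Rightarrow> nat \<Rightarrow> enat) \<Rightarrow> nat \<Rightarrow> nat \<Rightarrow> int" where
  "bracket_int m i j = \<lfloor>bracket m i j\<rfloor>"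

text \<open>Column \<open>j\<close> of \<open>burau_mat n m i\<close> is \<open>e\<^sub>j - \<langle>e\<^sub>i, e\<^sub>j\<rangle> e\<^sub>i\<close>.\<close>

definition burau_mat :: "nat \<Rightarrow> (nat \<Rightarrow> nat \<Rightarrow> enat) \<Rightarrow> nat \<Rightarrow> int mat" where
  "burau_mat n m i =
    mat n n (\<lambda>(k, j). (if k = j then 1 else 0) - (if k = i then bracket_int m i j else 0))"

definition GL :: "'r::comm_ring_1 itself \<Rightarrow> nat \<Rightarrow> 'r mat monoid" where
  "GL ty n = units_of (ring_mat ty n ())"

definition burau_rep :: "nat \<Rightarrow> (nat \<Rightarrow> nat \<Rightarrow> enat) \<Rightarrow> nat gword set \<Rightarrow> int mat" where
  "burau_rep n m = pres_lift (GL TYPE(int) n) (burau_mat n m)"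

definition reduce_mod2 :: "int mat \<Rightarrow> bit mat" where
  "reduce_mod2 = map_mat of_int"

definition artin_level2 :: "nat \<Rightarrow> (nat \<Rightarrow> nat \<Rightarrow> enat) \<Rightarrow> nat gword set set" where
  "artin_level2 n m =
    kernel (artin_group n m) (GL TYPE(bit) n) (\<lambda>x. reduce_mod2 (burau_rep n m x))"

lemma bracket_integral:
  assumes "coxeter_matrix n m" "small n m" "i < n" "j < n"
  shows "real_of_int (bracket_int m i j) = bracket m i j"
proof (cases "i = j")
  case False
  then have "m i j \<in> {1, 2, 3, \<infinity>}" "m i j \<ge> 2"
    using assms by (auto simp: coxeter_matrix_def small_def)
  then have "m i j \<in> {enat 2, enat 3, \<infinity>}" by (auto simp: numeral_eq_enat one_enat_def)
  then have "bracket m i j \<in> \<int>" by (auto simp: bracket_def cos_60)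
  then show ?thesis by (simp add: bracket_int_def)
qed (simp add: bracket_int_def bracket_def)

lemma GL_simps:
  "carrier (GL TYPE('r::comm_ring_1) n) =
    {A \<in> carrier_mat n n. \<exists>B \<in> carrier_mat n n. B * A = 1\<^sub>m n \<and> A * B = 1\<^sub>m n}"
  "\<one>\<^bsub>GL TYPE('r) n\<^esub> = 1\<^sub>m n"
  "A \<otimes>\<^bsub>GL TYPE('r) n\<^esub> B = A * B"
  by (auto simp: GL_def units_of_def ring_mat_def Units_def)

lemma group_GL: "group (GL TYPE('r::comm_ring_1) n)"
proof -
  interpret ring "ring_mat TYPE('r) n ()" by (rule ring_mat)
  show ?thesis unfolding GL_def by (rule units_group)
qed

lemma reduce_mod2_hom: "reduce_mod2 \<in> hom (GL TYPE(int) n) (GL TYPE(bit) n)"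
proof (rule homI)
  have mult: "reduce_mod2 (A * B) = reduce_mod2 A * reduce_mod2 B"
    if "A \<in> carrier_mat n n" "B \<in> carrier_mat n n" for A B
    using that unfolding reduce_mod2_def by (rule of_int_hom.mat_hom_mult)
  have one: "reduce_mod2 (1\<^sub>m n) = 1\<^sub>m n"
    unfolding reduce_mod2_def by (simp add: of_int_hom.mat_hom_one)
  have car: "A \<in> carrier_mat n n \<Longrightarrow> reduce_mod2 A \<in> carrier_mat n n" for A
    by (simp add: reduce_mod2_def)
  fix A assume A: "A \<in> carrier (GL TYPE(int) n)"
  then obtain A' where "A \<in> carrier_mat n n" "A' \<in> carrier_mat n n" "A' * A = 1\<^sub>m n" "A * A' = 1\<^sub>m n"
    by (auto simp: GL_simps)
  then show "reduce_mod2 A \<in> carrier (GL TYPE(bit) n)"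
    unfolding GL_simps using mult one car by (metis (mono_tags, lifting) mem_Collect_eq)
  fix B assume "B \<in> carrier (GL TYPE(int) n)"
  then show "reduce_mod2 (A \<otimes>\<^bsub>GL TYPE(int) n\<^esub> B) =
      reduce_mod2 A \<otimes>\<^bsub>GL TYPE(bit) n\<^esub> reduce_mod2 B"
    using A mult by (auto simp: GL_simps)
qed

definition transvection :: "nat \<Rightarrow> nat \<Rightarrow> (nat \<Rightarrow> int) \<Rightarrow> int mat" where
  "transvection n i g = mat n n (\<lambda>(k, j). (if k = j then 1 else 0) - (if k = i then g j else 0))"

lemma transvection_dim [simp]:
  "dim_row (transvection n i g) = n" "dim_col (transvection n i g) = n"
  by (simp_all add: transvection_def)

lemma transvection_mult_index:
  assumes "M \<in> carrier_mat n n" "k < n" "l < n"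
  shows "(transvection n i g * M) $$ (k, l) =
    M $$ (k, l) - (if k = i then (\<Sum>t<n. g t * M $$ (t, l)) else 0)"
proof -
  have "(transvection n i g * M) $$ (k, l) =
      (\<Sum>t<n. ((if k = t then 1 else 0) - (if k = i then g t else 0)) * M $$ (t, l))"
    using assms by (simp add: transvection_def scalar_prod_def lessThan_atLeast0)
  also have "\<dots> = (\<Sum>t<n. (if k = t then M $$ (t, l) else 0)) -
      (\<Sum>t<n. (if k = i then g t * M $$ (t, l) else 0))"
    unfolding sum_subtractf[symmetric] by (rule sum.cong) (auto simp: algebra_simps)
  finally show ?thesis using assms(2) by (simp add: sum.delta)
qed

lemma sum_delta_pick:
  fixes g :: "nat \<Rightarrow> int"
  assumes "i < n"
  shows "(\<Sum>t<n. g t * (if t = i then c else 0)) = g i * c"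
    "(\<Sum>t<n. g t * (if i = t then c else 0)) = g i * c"
proof -
  have "(\<Sum>t<n. g t * (if t = i then c else 0)) = (\<Sum>t<n. if t = i then g t * c else 0)"
    by (rule sum.cong) auto
  then show "(\<Sum>t<n. g t * (if t = i then c else 0)) = g i * c" using assms by simp
  then show "(\<Sum>t<n. g t * (if i = t then c else 0)) = g i * c"
    by (simp add: eq_commute[of i])
qed

lemma transvection_mult2_index:
  assumes "k < n" "l < n" "i < n" "j < n"
  shows "(transvection n i g * transvection n j h) $$ (k, l) =
    (if k = l then 1 else 0) - (if k = j then h l else 0) - (if k = i then g l - g j * h l else 0)"
proof -
  have "(\<Sum>t<n. g t * transvection n j h $$ (t, l)) = g l - g j * h l"
  proof -
    have "(\<Sum>t<n. g t * transvection n j h $$ (t, l)) =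
        (\<Sum>t<n. g t * (if t = l then 1 else 0)) - (\<Sum>t<n. g t * (if t = j then h l else 0))"
      unfolding sum_subtractf[symmetric]
      by (rule sum.cong) (use assms in \<open>auto simp: transvection_def algebra_simps\<close>)
    then show ?thesis using assms by (simp only: sum_delta_pick mult_1_right)
  qed
  moreover have "transvection n j h \<in> carrier_mat n n" by (simp add: transvection_def)
  ultimately show ?thesis using assms
    by (subst transvection_mult_index) (auto simp: transvection_def)
qed

lemma transvection_mult3_index:
  assumes "k < n" "l < n" "i < n" "j < n"
  shows "(transvection n i g * (transvection n j h * transvection n i g)) $$ (k, l) =
    (if k = l then 1 else 0) - (if k = i then g l else 0) - (if k = j then h l - h i * g l else 0)
      - (if k = i then g l - g i * g l - g j * (h l - h i * g l) else 0)"
proof -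
  let ?M = "transvection n j h * transvection n i g"
  have "(\<Sum>t<n. g t * ?M $$ (t, l)) = (\<Sum>t<n. g t * (if t = l then 1 else 0))
      - (\<Sum>t<n. g t * (if t = i then g l else 0))
      - (\<Sum>t<n. g t * (if t = j then h l - h i * g l else 0))"
    unfolding sum_subtractf[symmetric]
    by (rule sum.cong) (use assms in \<open>auto simp: transvection_mult2_index algebra_simps simp del: index_mult_mat(1)\<close>)
  then have "(\<Sum>t<n. g t * ?M $$ (t, l)) = g l - g i * g l - g j * (h l - h i * g l)"
    using assms by (simp only: sum_delta_pick mult_1_right)
  moreover have "?M \<in> carrier_mat n n"
    by (rule mult_carrier_mat[where n = n]) (simp_all add: transvection_def)
  ultimately show ?thesis using assms
    by (subst transvection_mult_index) (auto simp: transvection_mult2_index simp del: index_mult_mat(1))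
qed

lemma burau_mat_transvection: "burau_mat n m i = transvection n i (bracket_int m i)"
  by (simp add: burau_mat_def transvection_def)

lemma bracket_int_self [simp]: "bracket_int m i i = 0"
  by (simp add: bracket_int_def bracket_def)

lemma burau_mat_GL:
  assumes "i < n"
  shows "burau_mat n m i \<in> carrier (GL TYPE(int) n)"
proof -
  let ?A = "burau_mat n m i" and ?B = "transvection n i (\<lambda>j. - bracket_int m i j)"
  have "?A * ?B = 1\<^sub>m n" "?B * ?A = 1\<^sub>m n"
    unfolding burau_mat_transvection
    by (rule eq_matI; use assms in \<open>auto simp: transvection_mult2_index simp del: index_mult_mat(1)\<close>)+
  moreover have "?A \<in> carrier_mat n n" "?B \<in> carrier_mat n n"
    by (simp_all add: burau_mat_def transvection_def)
  ultimately show ?thesis unfolding GL_simps by blast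
qed

lemma burau_mat_commute:
  assumes "i < n" "j < n" "bracket_int m i j = 0" "bracket_int m j i = 0"
  shows "burau_mat n m i * burau_mat n m j = burau_mat n m j * burau_mat n m i"
  unfolding burau_mat_transvection
  by (rule eq_matI) (use assms in \<open>auto simp: transvection_mult2_index simp del: index_mult_mat(1)\<close>)

lemma burau_mat_braid:
  assumes "i < n" "j < n" "bracket_int m i j * bracket_int m j i = - 1"
  shows "burau_mat n m i * (burau_mat n m j * burau_mat n m i) =
    burau_mat n m j * (burau_mat n m i * burau_mat n m j)"
proof (rule eq_matI)
  fix k l assume "k < dim_row (burau_mat n m j * (burau_mat n m i * burau_mat n m j))"
    "l < dim_col (burau_mat n m j * (burau_mat n m i * burau_mat n m j))"
  then have kl: "k < n" "l < n" by (simp_all add: burau_mat_def)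
  have ab: "a * (q - b * p) = a * q + p" if "a * b = - 1" for a b p q :: int
  proof -
    have "a * (q - b * p) = a * q - (a * b) * p" by (simp add: right_diff_distrib)
    then show ?thesis by (simp add: that)
  qed
  have ij: "i \<noteq> j" using assms(3) by auto
  note * = ab[OF assms(3)] ab[OF assms(3)[unfolded mult.commute[of "bracket_int m i j"]]]
  show "(burau_mat n m i * (burau_mat n m j * burau_mat n m i)) $$ (k, l) =
      (burau_mat n m j * (burau_mat n m i * burau_mat n m j)) $$ (k, l)"
    unfolding burau_mat_transvection using assms(1,2) kl ij
    by (simp add: transvection_mult3_index * del: index_mult_mat(1))
qed (simp_all add: burau_mat_def)

lemma burau_mat_relations:
  assumes cox: "coxeter_matrix n m" and small: "small n m"
    and uv: "(u, v) \<in> artin_relations n m"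
  shows "word_value (GL TYPE(int) n) (burau_mat n m) u =
    word_value (GL TYPE(int) n) (burau_mat n m) v"
proof -
  obtain i j k where u: "u = alt_word k i j" and v: "v = alt_word k j i"
    and ij: "i < n" "j < n" "i \<noteq> j" and k: "m i j = enat k"
    using uv by (auto simp: artin_relations_def)
  have car: "burau_mat n m t \<in> carrier_mat n n" for t by (simp add: burau_mat_def)
  have k': "m j i = enat k" using cox ij k by (auto simp: coxeter_matrix_def)
  have "m i j \<in> {1, 2, 3, \<infinity>}" "m i j \<ge> 2"
    using cox small ij by (auto simp: coxeter_matrix_def small_def)
  then have "k = 2 \<or> k = 3" using k by (auto simp: numeral_eq_enat one_enat_def)
  then show ?thesis
  proof
    assume [simp]: "k = 2"
    have "bracket_int m i j = 0" "bracket_int m j i = 0"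
      using k k' by (simp_all add: bracket_int_def bracket_def)
    then show ?thesis using burau_mat_commute[OF ij(1,2)] car[of i] car[of j]
      by (simp add: u v numeral_2_eq_2 letter_value_def GL_simps)
  next
    assume [simp]: "k = 3"
    have "\<lfloor>- 1 :: real\<rfloor> = - 1" by linarith
    then have "bracket_int m i j * bracket_int m j i = - 1"
      using k k' ij by (simp add: bracket_int_def bracket_def cos_60)
    then show ?thesis using burau_mat_braid[OF ij(1,2)] car[of i] car[of j]
      by (simp add: u v numeral_3_eq_3 letter_value_def GL_simps)
  qed
qed

lemma burau_rep_hom:
  assumes "coxeter_matrix n m" "small n m"
  shows "burau_rep n m \<in> hom (artin_group n m) (GL TYPE(int) n)"
  unfolding burau_rep_def artin_group_def
  using assms by (intro pres_lift_hom group_GL burau_mat_relations) (auto intro: burau_mat_GL)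

lemma burau_rep_gen:
  assumes "coxeter_matrix n m" "small n m" "i < n"
  shows "burau_rep n m (artin_gen n m i) = burau_mat n m i"
  unfolding burau_rep_def artin_gen_def
  using assms by (intro pres_lift_gen group_GL burau_mat_relations) (auto intro: burau_mat_GL)

end

theory Submission
  imports Defs
begin

text \<open>Modulo two, the matrices of the generators (and of their inverses) agree with those of the
  reflection representation of the Coxeter group, so an element of the Artin group lies in the
  level two subgroup iff its image \<open>w\<close> acts trivially modulo two on the root lattice.

  If the group is finite, averaging a scalar product shows that the canonical form is positive
  definite. If \<open>w e\<^sub>i = e\<^sub>i + 2 g\<close> then evenness and positivity of the form force \<open>g = 0\<close> or
  \<open>g = - e\<^sub>i\<close>. Hence \<open>w\<close> maps every simple root to itself or its negative, so it commutes with
  all simple reflections, and it is central because the reflection representation is faithful.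
  Conversely, an element commuting with the \<open>i\<close>-th reflection preserves its \<open>- 1\<close>-eigenspace,
  which is spanned by \<open>e\<^sub>i\<close>.\<close>

section \<open>Unit vectors, positive words and a parity lemma\<close>

definition unit_fun :: "nat \<Rightarrow> nat \<Rightarrow> int" where
  "unit_fun i = (\<lambda>k. if k = i then 1 else 0)"

definition positive_word :: "'a list \<Rightarrow> 'a gword" where
  "positive_word xs = map (\<lambda>x. (x, True)) xs"

lemma positive_word_simps [simp]:
  "positive_word [] = []"
  "positive_word (x # xs) = (x, True) # positive_word xs"
  "positive_word (xs @ ys) = positive_word xs @ positive_word ys"
  "map fst (positive_word xs) = xs"
  by (simp_all add: positive_word_def comp_def)

lemma positive_word_gwords [simp]: "positive_word xs \<in> gwords S \<longleftrightarrow> set xs \<subseteq> S"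
  by (induction xs) auto

text \<open>The terms at (i, j) and (j, i) pair up, which leaves only the even diagonal terms modulo
  two.\<close>

lemma even_symmetric_double_sum:
  fixes f :: "nat \<Rightarrow> nat \<Rightarrow> int"
  assumes "\<And>i j. i < n \<Longrightarrow> j < n \<Longrightarrow> f i j = f j i" "\<And>i. i < n \<Longrightarrow> even (f i i)"
  shows "even (\<Sum>i<n. \<Sum>j<n. f i j)"
  using assms
proof (induction n)
  case (Suc n)
  have "(\<Sum>i<Suc n. \<Sum>j<Suc n. f i j) =
      (\<Sum>i<n. \<Sum>j<n. f i j) + (\<Sum>i<n. f i n) + (\<Sum>j<n. f n j) + f n n"
    by (simp add: sum.distrib)
  moreover have "(\<Sum>j<n. f n j) = (\<Sum>i<n. f i n)"
    by (rule sum.cong) (use Suc.prems(1) in auto)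
  moreover have "even (\<Sum>i<n. \<Sum>j<n. f i j)" using Suc by simp
  moreover have "even (f n n)" using Suc.prems by simp
  ultimately show ?case by simp
qed simp

section \<open>The reflection representation on the root lattice\<close>

locale small_coxeter =
  fixes n :: nat and m :: "nat \<Rightarrow> nat \<Rightarrow> enat"
  assumes cox: "coxeter_matrix n m" and small: "small n m"
begin

text \<open>The matrix of -2 cos(\<pi> / \<open>m i j\<close>), that is, the canonical form on
  simple roots of norm 2. For distinct vertices below \<open>n\<close> the last branch is the label
  \<infinity>, by \<open>m_cases\<close>.\<close>

definition gram :: "nat \<Rightarrow> nat \<Rightarrow> int" where
  "gram i j = (if i = j then 2 else if m i j = 2 then 0 else if m i j = 3 then - 1 else - 2)"

definition pair :: "nat \<Rightarrow> (nat \<Rightarrow> int) \<Rightarrow> int" where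
  "pair i x = (\<Sum>j<n. gram i j * x j)"

definition form :: "(nat \<Rightarrow> int) \<Rightarrow> (nat \<Rightarrow> int) \<Rightarrow> int" where
  "form x y = (\<Sum>i<n. x i * pair i y)"

text \<open>Vectors are functions on all natural numbers; \<open>pair\<close> reads only the
  coordinates below \<open>n\<close>, and for \<open>i < n\<close> the reflection changes only
  coordinate \<open>i\<close>.\<close>

definition refl :: "nat \<Rightarrow> (nat \<Rightarrow> int) \<Rightarrow> nat \<Rightarrow> int" where
  "refl i x = (\<lambda>k. x k - pair i x * unit_fun i k)"

definition act :: "nat list \<Rightarrow> (nat \<Rightarrow> int) \<Rightarrow> nat \<Rightarrow> int" where
  "act xs = foldr refl xs"

lemma m_cases:
  assumes "i < n" "j < n" "i \<noteq> j"
  shows "m i j = 2 \<or> m i j = 3 \<or> m i j = \<infinity>"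
proof -
  have "m i j \<in> {1, 2, 3, \<infinity>}" "2 \<le> m i j"
    using cox small assms by (auto simp: coxeter_matrix_def small_def)
  then show ?thesis by (auto simp: numeral_eq_enat one_enat_def)
qed

lemma m_diag: "i < n \<Longrightarrow> m i i = 1"
  using cox by (simp add: coxeter_matrix_def)

lemma m_sym: "i < n \<Longrightarrow> j < n \<Longrightarrow> m i j = m j i"
  using cox by (simp add: coxeter_matrix_def)

lemma gram_diag [simp]: "gram i i = 2"
  by (simp add: gram_def)

lemma gram_sym: "i < n \<Longrightarrow> j < n \<Longrightarrow> gram i j = gram j i"
  by (simp add: gram_def m_sym)

lemma act_simps [simp]:
  "act [] = (\<lambda>x. x)"
  "act (i # xs) x = refl i (act xs x)"
  "act (xs @ ys) x = act xs (act ys x)"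
  by (auto simp: act_def)

lemma pair_unit [simp]: "j < n \<Longrightarrow> pair i (unit_fun j) = gram i j"
  by (simp add: pair_def unit_fun_def if_distrib cong: if_cong)

text \<open>Linearity is stated in the shape of a reflection, here and for \<open>act\<close>,
  \<open>form\<close> and \<open>avg\<close>; sums are obtained from negative
  \<open>c\<close>.\<close>

lemma pair_diff: "pair i (\<lambda>k. x k - c * y k) = pair i x - c * pair i y"
  by (simp add: pair_def sum_distrib_left sum_subtractf algebra_simps)

lemma pair_refl: "j < n \<Longrightarrow> pair i (refl j x) = pair i x - pair j x * gram i j"
  by (simp add: refl_def pair_diff)

lemma refl_apply: "refl i x k = x k - pair i x * (if k = i then 1 else 0)"
  by (simp add: refl_def unit_fun_def)

lemma refl_refl [simp]: "i < n \<Longrightarrow> refl i (refl i x) = x"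
  by (rule ext) (simp add: refl_apply pair_refl)

lemma refl_commute:
  assumes "i < n" "j < n" "m i j = 2"
  shows "refl i (refl j x) = refl j (refl i x)"
proof -
  have "i \<noteq> j" using assms m_diag[of i] by auto
  then have "gram i j = 0" "gram j i = 0" using assms m_sym[of i j] by (simp_all add: gram_def)
  then show ?thesis using assms by (intro ext) (simp add: refl_apply pair_refl)
qed

lemma refl_braid:
  assumes "i < n" "j < n" "m i j = 3"
  shows "refl i (refl j (refl i x)) = refl j (refl i (refl j x))"
proof -
  have "i \<noteq> j" using assms m_diag[of i] by (auto simp: one_enat_def numeral_eq_enat)
  then have "gram i j = - 1" "gram j i = - 1"
    using assms m_sym[of i j] by (simp_all add: gram_def)
  then show ?thesis using assms by (intro ext) (simp add: refl_apply pair_refl)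
qed

text \<open>Smallness leaves only the labels 1, 2 and 3 among the finite ones, so every relator is
  one of three explicit words.\<close>

lemma relation_cases:
  assumes "(u, v) \<in> coxeter_relations n m"
  obtains i where "i < n" "u = positive_word [i, i]" "v = []"
    | i j where "i < n" "j < n" "m i j = 2" "u = positive_word [i, j, i, j]" "v = []"
    | i j where "i < n" "j < n" "m i j = 3" "u = positive_word [i, j, i, j, i, j]" "v = []"
proof -
  obtain i j k where ij: "i < n" "j < n" "m i j = enat k"
    and u: "u = concat (replicate k [(i, True), (j, True)])" and v: "v = []"
    using assms by (auto simp: coxeter_relations_def)
  show thesis
  proof (cases "i = j")
    case True
    then have "k = 1" using ij m_diag[of i] by (simp add: one_enat_def)
    then show thesis using that(1) ij u v True by simp
  next
    case False
    then have "k = 2 \<or> k = 3" using m_cases[of i j] ij by (auto simp: numeral_eq_enat)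
    then show thesis
    proof
      assume "k = 2"
      then show thesis using that(2)[OF ij(1,2) _ _ v] ij(3) u
        by (simp add: numeral_eq_enat numeral_2_eq_2)
    next
      assume "k = 3"
      then show thesis using that(3)[OF ij(1,2) _ _ v] ij(3) u
        by (simp add: numeral_eq_enat numeral_3_eq_3)
    qed
  qed
qed

text \<open>Dropping the signs with \<open>map fst\<close> is harmless because each reflection is
  its own inverse.\<close>

lemma act_pres_eq:
  "pres_eq {..<n} (coxeter_relations n m) u v \<Longrightarrow> act (map fst u) = act (map fst v)"
proof (induction rule: pres_eq.induct)
  case (refl u)
  show ?case by (rule HOL.refl)
next
  case (sym u v)
  show ?case using sym.IH by (rule HOL.sym)
next
  case (trans u v w)
  show ?case using trans.IH by (rule HOL.trans)
next
  case (append u u' v v')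
  show ?case by (intro ext) (simp only: map_append act_simps append.IH)
next
  case (cancel x b)
  then show ?case by (simp add: fun_eq_iff)
next
  case (relation u v)
  from relation(1) show ?case
  proof (cases rule: relation_cases)
    case (1 i)
    show ?thesis using 1(1) unfolding 1(2,3) by (intro ext) simp
  next
    case (2 i j)
    have "refl i (refl j (refl i (refl j x))) = x" for x
      using 2(1,2) refl_commute[OF 2(1-3), of "refl i (refl j x)"] by simp
    then show ?thesis unfolding 2(4,5) by (intro ext) simp
  next
    case (3 i j)
    have "refl i (refl j (refl i (refl j (refl i (refl j x))))) = x" for x
      using 3(1,2) refl_braid[OF 3(1-3), of "refl j (refl i (refl j x))"] by simp
    then show ?thesis unfolding 3(4,5) by (intro ext) simp
  qed
qed

section \<open>Equality of positive words in the Coxeter group\<close>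

definition weq :: "nat list \<Rightarrow> nat list \<Rightarrow> bool" where
  "weq xs ys = pres_eq {..<n} (coxeter_relations n m) (positive_word xs) (positive_word ys)"

lemma weq_set: "weq xs ys \<Longrightarrow> set xs \<subseteq> {..<n} \<and> set ys \<subseteq> {..<n}"
  unfolding weq_def by (drule pres_eq_gwords) simp

lemma weq_refl: "set xs \<subseteq> {..<n} \<Longrightarrow> weq xs xs"
  by (simp add: weq_def pres_eq.refl)

lemma weq_sym: "weq xs ys \<Longrightarrow> weq ys xs"
  unfolding weq_def by (rule pres_eq.sym)

lemma weq_trans [trans]: "weq xs ys \<Longrightarrow> weq ys zs \<Longrightarrow> weq xs zs"
  unfolding weq_def by (rule pres_eq.trans)

lemma weq_append: "weq xs xs' \<Longrightarrow> weq ys ys' \<Longrightarrow> weq (xs @ ys) (xs' @ ys')"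
  unfolding weq_def positive_word_simps by (rule pres_eq.append)

lemma weq_act: "weq xs ys \<Longrightarrow> act xs = act ys"
  unfolding weq_def by (drule act_pres_eq) simp

lemma weq_relation:
  assumes "i < n" "j < n" "m i j = enat k"
  shows "weq (concat (replicate k [i, j])) []"
proof -
  have "positive_word (concat (replicate l [i, j])) = concat (replicate l [(i, True), (j, True)])" for l
    by (induction l) simp_all
  moreover have "concat (replicate l [(i, True), (j, True)]) \<in> gwords {..<n}" for l
    using assms by (induction l) simp_all
  ultimately show ?thesis
    unfolding weq_def using assms
    by (intro pres_eq.relation) (auto simp: coxeter_relations_def)
qed

lemma weq_square: "i < n \<Longrightarrow> weq [i, i] []"
  using weq_relation[of i i 1] m_diag[of i] by (simp add: one_enat_def)

text \<open>Right multiplication by the involution \<open>i\<close>. Repeated use turns a relator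
  into the commutation or braid relation.\<close>

lemma weq_cancel_right:
  assumes "weq (xs @ [i]) ys" "i < n"
  shows "weq xs (ys @ [i])"
proof -
  have "weq (xs @ []) (xs @ [i, i])"
    using assms weq_set[OF assms(1)] by (intro weq_append weq_refl weq_sym[OF weq_square]) auto
  also have "weq (xs @ [i, i]) (ys @ [i])"
    using weq_append[OF assms(1) weq_refl, of "[i]"] assms(2) by simp
  finally show ?thesis by simp
qed

lemma weq_rev: "set xs \<subseteq> {..<n} \<Longrightarrow> weq (xs @ rev xs) []"
proof (induction xs)
  case (Cons i xs)
  then have "weq ([i] @ (xs @ rev xs) @ [i]) ([i] @ [] @ [i])"
    by (intro weq_append weq_refl) auto
  also have "weq ([i] @ [] @ [i]) []" using weq_square[of i] Cons.prems by simp
  finally show ?case by simp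
qed (simp add: weq_refl)

lemma weq_rev': "set xs \<subseteq> {..<n} \<Longrightarrow> weq (rev xs @ xs) []"
  using weq_rev[of "rev xs"] by simp

lemma weq_commute:
  assumes "i < n" "j < n" "m i j = 2"
  shows "weq [i, j] [j, i]"
proof -
  have "weq [i, j, i, j] []"
    using weq_relation[of i j 2] assms by (simp add: numeral_eq_enat numeral_2_eq_2)
  then show ?thesis
    using weq_cancel_right[of "[i, j, i]" j "[]"] weq_cancel_right[of "[i, j]" i "[j]"] assms by simp
qed

lemma weq_braid:
  assumes "i < n" "j < n" "m i j = 3"
  shows "weq [i, j, i] [j, i, j]"
proof -
  have "weq [i, j, i, j, i, j] []"
    using weq_relation[of i j 3] assms by (simp add: numeral_eq_enat numeral_3_eq_3)
  then show ?thesis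
    using weq_cancel_right[of "[i, j, i, j, i]" j "[]"] weq_cancel_right[of "[i, j, i, j]" i "[j]"]
      weq_cancel_right[of "[i, j, i]" j "[j, i]"] assms by simp
qed

lemma pres_eq_positive:
  "u \<in> gwords {..<n} \<Longrightarrow>
    pres_eq {..<n} (coxeter_relations n m) u (positive_word (map fst u))"
proof (induction u)
  case Nil
  then show ?case by (simp add: pres_eq.refl)
next
  case (Cons a u)
  let ?eq = "pres_eq {..<n} (coxeter_relations n m)"
  obtain x b where a: "a = (x, b)" by (cases a)
  have x: "x < n" using Cons.prems a by simp
  have "?eq [(x, False)] [(x, True)]"
  proof -
    \<comment> \<open>Insert the trivial square of \<open>x\<close> after its formal inverse, then
      cancel the inverse against the first copy.\<close>
    have "?eq ([(x, False)] @ []) ([(x, False)] @ [(x, True), (x, True)])"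
      using weq_sym[OF weq_square[OF x]] x
      by (intro pres_eq.append pres_eq.refl) (auto simp: weq_def)
    moreover have "?eq ([(x, False), (x, True)] @ [(x, True)]) ([] @ [(x, True)])"
      using pres_eq.cancel[of x "{..<n}" _ False] x by (intro pres_eq.append pres_eq.refl) auto
    ultimately show ?thesis by (auto intro: pres_eq.trans)
  qed
  then have "?eq [a] [(x, True)]" using a x by (cases b) (auto intro: pres_eq.refl)
  then have "?eq ([a] @ u) ([(x, True)] @ positive_word (map fst u))"
    using Cons by (intro pres_eq.append) auto
  then show ?case using a by simp
qed

section \<open>Faithfulness of the reflection representation\<close>

text \<open>The Coxeter length of the group element, not the length of the list. The minimum exists
  only for words in letters below \<open>n\<close>.\<close>

definition len :: "nat list \<Rightarrow> nat" where
  "len xs = (LEAST k. \<exists>ys. weq xs ys \<and> length ys = k)"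

lemma len_le: "weq xs ys \<Longrightarrow> len xs \<le> length ys"
  unfolding len_def by (rule Least_le) blast

lemma reduced_word:
  assumes "set xs \<subseteq> {..<n}"
  obtains ys where "weq xs ys" "length ys = len xs"
proof -
  have "\<exists>k. \<exists>ys. weq xs ys \<and> length ys = k" using weq_refl[OF assms] by blast
  then have "\<exists>ys. weq xs ys \<and> length ys = len xs" unfolding len_def by (rule LeastI_ex)
  then show thesis using that by blast
qed

lemma len_append_le:
  assumes "weq xs (ys @ zs)"
  shows "len xs \<le> len ys + length zs"
proof -
  have s: "set ys \<subseteq> {..<n}" "set zs \<subseteq> {..<n}" using weq_set[OF assms] by auto
  obtain ys' where "weq ys ys'" "length ys' = len ys" using reduced_word s by blast
  moreover have "weq xs (ys' @ zs)"
    using weq_trans[OF assms weq_append[OF \<open>weq ys ys'\<close> weq_refl]] s by blast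
  ultimately show ?thesis using len_le by fastforce
qed

lemma len_cong_le: "weq xs ys \<Longrightarrow> len xs \<le> len ys"
  using len_append_le[of xs ys "[]"] by simp

lemma act_diff: "act xs (\<lambda>k. x k - c * y k) = (\<lambda>k. act xs x k - c * act xs y k)"
  by (induction xs) (auto simp: refl_def pair_diff algebra_simps)

lemma act_refl: "act xs (refl i x) = (\<lambda>k. act xs x k - pair i x * act xs (unit_fun i) k)"
  unfolding refl_def by (rule act_diff)

text \<open>This is the key step of the classical proof of faithfulness. With labels two and three only,
  the passage to a minimal representative modulo the dihedral subgroup generated by \<open>s\<close> and the
  last letter \<open>t\<close> of a reduced word takes at most two steps.\<close>

lemma act_unit_nonneg:
  assumes no_inf: "\<forall>i<n. \<forall>j<n. m i j \<noteq> \<infinity>"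
    and "set xs \<subseteq> {..<n}" "s < n" "len xs \<le> len (xs @ [s])"
  shows "0 \<le> act xs (unit_fun s) k"
  using assms(2-)
proof (induction "len xs" arbitrary: xs s rule: less_induct)
  case less
  note xs = \<open>set xs \<subseteq> {..<n}\<close> and s = \<open>s < n\<close>
  obtain zs where zs: "weq xs zs" "length zs = len xs" using reduced_word xs by blast
  show ?case
  proof (cases zs rule: rev_cases)
    case Nil
    then show ?thesis using weq_act[OF zs(1)] by (simp add: unit_fun_def)
  next
    case (snoc u t)
    have u: "set u \<subseteq> {..<n}" and t: "t < n" using weq_set[OF zs(1)] snoc by auto
    have xu: "weq xs (u @ [t])" using zs snoc by simp
    have lu: "len u < len xs" using len_le[OF weq_refl[OF u]] zs snoc by simp
    have xs_s: "weq (xs @ [s]) (u @ [t, s])"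
      using weq_append[OF xu weq_refl, of "[s]"] s by simp
    have act: "act xs x = act u (refl t x)" for x using weq_act[OF xu] by simp
    have ts: "t \<noteq> s"
    proof
      assume "t = s"
      then have "weq (xs @ [s]) (u @ [])"
        using weq_trans[OF xs_s] weq_append[OF weq_refl[OF u] weq_square[OF t]] by simp
      then have "len (xs @ [s]) \<le> len u" using len_append_le by fastforce
      then show False using lu less.prems by simp
    qed
    have len_ut: "len xs \<le> len (u @ [t])" using len_cong_le[OF xu] .
    have gram: "m t s = 2 \<and> gram t s = 0 \<or> m t s = 3 \<and> gram t s = - 1"
      using m_cases[OF t s ts] no_inf t s ts by (auto simp: gram_def)
    have act_s: "act xs (unit_fun s) k = act u (unit_fun s) k - gram t s * act u (unit_fun t) k"
      using act[of "unit_fun s"] s by (simp add: act_refl)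
    show ?thesis
    proof (cases "len u \<le> len (u @ [s])")
      \<comment> \<open>Both vectors in \<open>act_s\<close> are nonnegative by induction, as
        \<open>u @ [t]\<close> represents \<open>xs\<close> and so is not shorter than
        \<open>u\<close>; the coefficient \<open>- gram t s\<close> is 0 or 1.\<close>
      case True
      then have "0 \<le> act u (unit_fun s) k" using less.hyps[OF lu u s] by simp
      moreover have "0 \<le> act u (unit_fun t) k" using less.hyps[OF lu u t] len_ut lu by simp
      ultimately show ?thesis using act_s gram by auto
    next
      case False
      \<comment> \<open>Now \<open>v\<close> is at least two shorter than \<open>xs\<close>, and
        \<open>xs @ [s]\<close> equals \<open>v @ [s, t, s]\<close>.\<close>
      define v where "v = u @ [s]"
      have v: "set v \<subseteq> {..<n}" using u s by (simp add: v_def)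
      have lv: "len v < len u" using False by (simp add: v_def)
      have uv: "weq u (v @ [s])"
        unfolding v_def using weq_cancel_right[OF weq_refl s] v by (simp add: v_def)
      have xs_s': "weq (xs @ [s]) (v @ [s, t, s])"
        using weq_trans[OF xs_s weq_append[OF uv weq_refl, of "[t, s]"]] s t by simp
      show ?thesis
      proof (cases "m t s = 2")
        case True
        \<comment> \<open>This label is impossible: \<open>xs @ [s]\<close> would have length at
          most \<open>len v + 1\<close>, which is less than \<open>len xs\<close>.\<close>
        have "weq (v @ [s, t, s]) (v @ [s, s, t])"
          using weq_append[OF weq_refl[of "v @ [s]"] weq_commute[OF t s True]] v s by simp
        also have "weq (v @ [s, s, t]) (v @ [t])"
          using weq_append[OF weq_refl[OF v] weq_append[OF weq_square[OF s] weq_refl, of "[t]"]] t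
          by simp
        finally have "weq (xs @ [s]) (v @ [t])" using weq_trans[OF xs_s'] by blast
        then have "len (xs @ [s]) \<le> len v + 1" using len_append_le by fastforce
        then show ?thesis using less.prems lv lu by simp
      next
        case False
        then have m3: "m t s = 3" "gram t s = - 1" using gram by auto
        \<comment> \<open>The length bound shows that \<open>v @ [t]\<close> is not shorter than
          \<open>v\<close>, so induction applies to \<open>v\<close> and \<open>t\<close>. The
          vector is the right one because the reflections \<open>t\<close>, then \<open>s\<close>,
          carry the root \<open>s\<close> to the root \<open>t\<close>.\<close>
        have "weq (xs @ [s]) (v @ [t, s, t])"
          using weq_trans[OF xs_s' weq_append[OF weq_refl[OF v] weq_braid[OF s t]]] m3 m_sym[OF s t]
          by simp
        then have "len (xs @ [s]) \<le> len (v @ [t]) + 2"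
          using len_append_le[of "xs @ [s]" "v @ [t]" "[s, t]"] by simp
        then have "len v \<le> len (v @ [t])" using less.prems lv lu by simp
        then have "0 \<le> act v (unit_fun t) k" using less.hyps[OF _ v t] lv lu by simp
        moreover have "act xs (unit_fun s) = act v (unit_fun t)"
        proof -
          have "refl s (refl t (unit_fun s)) = unit_fun t"
            using s t ts m3 gram_sym[OF s t] by (intro ext) (simp add: refl_def[of s] pair_refl, simp add: refl_def)
          then show ?thesis using act[of "unit_fun s"] weq_act[OF uv] by simp
        qed
        ultimately show ?thesis by simp
      qed
    qed
  qed
qed

text \<open>If a reduced word ended in \<open>t\<close>, its remaining part \<open>u\<close> would
  send the root \<open>t\<close> to a nonnegative vector by \<open>act_unit_nonneg\<close>, but also
  to minus the root \<open>t\<close>.\<close>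

lemma act_faithful:
  assumes no_inf: "\<forall>i<n. \<forall>j<n. m i j \<noteq> \<infinity>"
    and xs: "set xs \<subseteq> {..<n}" and id: "\<And>j. j < n \<Longrightarrow> act xs (unit_fun j) = unit_fun j"
  shows "weq xs []"
proof -
  obtain zs where zs: "weq xs zs" "length zs = len xs" using reduced_word xs by blast
  show ?thesis
  proof (cases zs rule: rev_cases)
    case Nil
    then show ?thesis using zs by simp
  next
    case (snoc u t)
    have u: "set u \<subseteq> {..<n}" and t: "t < n" using weq_set[OF zs(1)] snoc by auto
    have "len u \<le> len xs" using len_le[OF weq_refl[OF u]] zs snoc by simp
    also have "len xs \<le> len (u @ [t])" using len_cong_le[OF zs(1)] snoc by simp
    finally have "0 \<le> act u (unit_fun t) t" by (rule act_unit_nonneg[OF no_inf u t])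
    moreover have "unit_fun t t = - act u (unit_fun t) t"
      using weq_act[OF zs(1)] id[OF t] snoc t act_refl[of u t "unit_fun t"] by (simp add: fun_eq_iff)
    ultimately show ?thesis by (simp add: unit_fun_def)
  qed
qed

section \<open>Positive definiteness for finite groups\<close>

lemma form_unit [simp]: "i < n \<Longrightarrow> form (unit_fun i) y = pair i y"
  by (simp add: form_def unit_fun_def if_distrib[of "\<lambda>z. z * _"] cong: if_cong)

lemma form_sym: "form x y = form y x"
proof -
  have "form x y = (\<Sum>i<n. \<Sum>j<n. x i * (gram i j * y j))"
    by (simp add: form_def pair_def sum_distrib_left)
  also have "\<dots> = (\<Sum>j<n. \<Sum>i<n. y j * (gram j i * x i))"
    by (subst sum.swap) (intro sum.cong HOL.refl, auto simp: gram_sym)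
  also have "\<dots> = form y x"
    by (simp add: form_def pair_def sum_distrib_left)
  finally show ?thesis .
qed

lemma form_diff_right: "form x (\<lambda>k. y k - c * z k) = form x y - c * form x z"
  by (simp add: form_def pair_diff sum_distrib_left sum_subtractf algebra_simps)

lemma form_diff_left: "form (\<lambda>k. y k - c * z k) x = form y x - c * form z x"
  using form_diff_right[of x y c z] by (simp add: form_sym[of x])

lemma form_refl:
  assumes "i < n"
  shows "form (refl i x) (refl i y) = form x y"
proof -
  have "form x (unit_fun i) = pair i x" for x using assms form_sym[of x] by simp
  then show ?thesis
    by (simp only: refl_def form_diff_left form_diff_right form_unit[OF assms] pair_unit[OF assms] gram_diag)
      (simp add: algebra_simps)
qed

lemma form_scale: "form (\<lambda>k. c * x k) y = c * form x y" "form x (\<lambda>k. c * y k) = c * form x y"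
  by (simp_all add: form_def pair_def sum_distrib_left algebra_simps)

lemma form_act: "set xs \<subseteq> {..<n} \<Longrightarrow> form (act xs x) (act xs y) = form x y"
  by (induction xs) (auto simp: form_refl)

text \<open>The root lattice is even because the diagonal entries of \<open>gram\<close> are
  2.\<close>

lemma even_form: "even (form x x)"
proof -
  have "form x x = (\<Sum>i<n. \<Sum>j<n. x i * (gram i j * x j))"
    by (simp add: form_def pair_def sum_distrib_left)
  moreover have "even (\<Sum>i<n. \<Sum>j<n. x i * (gram i j * x j))"
    by (rule even_symmetric_double_sum) (auto simp: gram_sym)
  ultimately show ?thesis by simp
qed

text \<open>The image of the group under the reflection representation; averaging needs only its
  finiteness and its stability under composition with reflections.\<close>

definition ops :: "((nat \<Rightarrow> int) \<Rightarrow> nat \<Rightarrow> int) set" where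
  "ops = act ` {xs. set xs \<subseteq> {..<n}}"

lemma finite_ops:
  assumes "spherical n m"
  shows "finite ops"
proof (rule finite_surj)
  show "finite (carrier (coxeter_group n m))" using assms by (simp add: spherical_def)
  \<comment> \<open>The choice of representative does not matter, since \<open>act_pres_eq\<close>
    makes the operator constant on each class.\<close>
  show "ops \<subseteq> (\<lambda>X. act (map fst (SOME u. u \<in> X))) ` carrier (coxeter_group n m)"
  proof
    fix f assume "f \<in> ops"
    then obtain xs where xs: "set xs \<subseteq> {..<n}" and f: "f = act xs" by (auto simp: ops_def)
    let ?R = "pres_rel {..<n} (coxeter_relations n m)"
    let ?X = "?R `` {positive_word xs}"
    have "positive_word xs \<in> ?X"
      using xs by (simp add: pres_rel_def pres_eq.refl)
    then have "(SOME u. u \<in> ?X) \<in> ?X" by (rule someI)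
    then have "act (map fst (SOME u. u \<in> ?X)) = f"
      using act_pres_eq[of "positive_word xs"] by (simp add: pres_rel_def f)
    moreover have "?X \<in> carrier (coxeter_group n m)"
      using xs by (simp add: coxeter_group_def pres_class_carrier)
    ultimately show "f \<in> (\<lambda>X. act (map fst (SOME u. u \<in> X))) ` carrier (coxeter_group n m)"
      by blast
  qed
qed

text \<open>The standard scalar product on the first \<open>n\<close> coordinates summed over all
  operators; without normalisation it stays integral. A pair \<open>p\<close> consists of an
  operator and a coordinate.\<close>

definition avg :: "(nat \<Rightarrow> int) \<Rightarrow> (nat \<Rightarrow> int) \<Rightarrow> int" where
  "avg x y = (\<Sum>p\<in>ops \<times> {..<n}. fst p x (snd p) * fst p y (snd p))"

lemma avg_sym: "avg x y = avg y x"
  by (simp add: avg_def mult.commute)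

lemma avg_diff_left: "avg (\<lambda>k. x k - c * y k) z = avg x z - c * avg y z"
  unfolding avg_def sum_distrib_left sum_subtractf[symmetric]
  by (rule sum.cong) (auto simp: ops_def act_diff algebra_simps)

lemma avg_diff_right: "avg z (\<lambda>k. x k - c * y k) = avg z x - c * avg z y"
  using avg_diff_left[of x c y z] by (simp add: avg_sym[of z])

lemma ops_refl: "i < n \<Longrightarrow> f \<in> ops \<Longrightarrow> f \<circ> refl i \<in> ops"
proof -
  assume "i < n" "f \<in> ops"
  then obtain xs where "set (xs @ [i]) \<subseteq> {..<n}" "f = act xs" by (auto simp: ops_def)
  moreover have "act (xs @ [i]) = act xs \<circ> refl i" by (intro ext) simp
  ultimately show ?thesis unfolding ops_def by (metis (mono_tags, lifting) image_eqI mem_Collect_eq)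
qed

text \<open>Precomposition with \<open>refl i\<close> is an involution of \<open>ops\<close>, so it
  only permutes the summands.\<close>

lemma avg_refl:
  assumes "i < n"
  shows "avg (refl i x) (refl i y) = avg x y"
  unfolding avg_def
  by (rule sum.reindex_bij_witness[where i = "\<lambda>p. (fst p \<circ> refl i, snd p)"
        and j = "\<lambda>p. (fst p \<circ> refl i, snd p)"])
    (use assms ops_refl in \<open>auto simp: fun_eq_iff\<close>)

text \<open>Compare the value before and after \<open>refl i\<close>, which negates the root
  \<open>i\<close> and subtracts \<open>gram i j\<close> times it from the root
  \<open>j\<close>.\<close>

lemma avg_unit:
  assumes "i < n" "j < n"
  shows "2 * avg (unit_fun i) (unit_fun j) = gram i j * avg (unit_fun i) (unit_fun i)"
proof -
  have "avg (unit_fun i) (unit_fun j) = avg (refl i (unit_fun i)) (refl i (unit_fun j))"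
    using assms by (simp add: avg_refl)
  also have "\<dots> = - avg (unit_fun i) (unit_fun j) + gram i j * avg (unit_fun i) (unit_fun i)"
    by (simp only: refl_def pair_unit assms gram_diag avg_diff_left avg_diff_right)
      (simp add: algebra_simps)
  finally show ?thesis by simp
qed

lemma id_ops: "(\<lambda>x. x) \<in> ops"
  unfolding ops_def by (rule image_eqI[of _ _ "[]"]) simp_all

text \<open>All summands are squares, and the identity operator at coordinate \<open>i\<close>
  contributes 1.\<close>

lemma avg_unit_pos:
  assumes "spherical n m" "i < n"
  shows "0 < avg (unit_fun i) (unit_fun i)"
proof -
  have "fst p (unit_fun i) (snd p) * fst p (unit_fun i) (snd p) \<le> avg (unit_fun i) (unit_fun i)"
    if "p \<in> ops \<times> {..<n}" for p
    unfolding avg_def using assms finite_ops that by (intro member_le_sum) auto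
  from this[of "(\<lambda>x. x, i)"] show ?thesis using assms id_ops by (simp add: unit_fun_def)
qed

text \<open>The averaged invariant form determines \<open>form\<close> up to a positive factor on each
  connected component; dividing by square roots of the factors absorbs them.\<close>

lemma form_scaled_sum_squares:
  assumes "spherical n m"
  defines "s \<equiv> \<lambda>i. sqrt (avg (unit_fun i) (unit_fun i))"
  shows "real_of_int (form x x) =
    2 * (\<Sum>p\<in>ops \<times> {..<n}. (\<Sum>i<n. x i / s i * fst p (unit_fun i) (snd p))\<^sup>2)"
proof -
  have s: "0 < s i" "(s i)\<^sup>2 = avg (unit_fun i) (unit_fun i)" if "i < n" for i
    using avg_unit_pos[OF assms(1) that] by (simp_all add: s_def)
  \<comment> \<open>By \<open>avg_unit\<close> for (i, j) and for (j, i), a nonzero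
    \<open>gram i j\<close> forces \<open>s i = s j\<close>; if it is zero, so is the averaged
    product.\<close>
  have entry: "gram i j = 2 * (1 / s i * (1 / s j) * avg (unit_fun i) (unit_fun j))"
    if ij: "i < n" "j < n" for i j
  proof -
    have 1: "2 * real_of_int (avg (unit_fun i) (unit_fun j)) = gram i j * (s i)\<^sup>2"
      "2 * real_of_int (avg (unit_fun i) (unit_fun j)) = gram i j * (s j)\<^sup>2"
      using avg_unit[OF ij] avg_unit[OF ij(2,1)] s ij gram_sym[OF ij] avg_sym[of "unit_fun i" "unit_fun j"]
      by (metis of_int_mult of_int_numeral)+
    show ?thesis
    proof (cases "gram i j = 0")
      case True
      then show ?thesis using 1 by simp
    next
      case False
      then have "(s i)\<^sup>2 = (s j)\<^sup>2" using 1 by simp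
      then have "s i = s j"
        by (rule power2_eq_imp_eq) (use s(1) ij in \<open>auto intro: less_imp_le\<close>)
      then show ?thesis using 1(2) s(1)[OF ij(2)] by (simp add: field_simps power2_eq_square)
    qed
  qed
  \<comment> \<open>With the sum over \<open>p\<close> moved outermost, the double sum over
    \<open>i\<close> and \<open>j\<close> becomes the square of the sum of
    \<open>T p i\<close>.\<close>
  define T where "T p i = x i / s i * fst p (unit_fun i) (snd p)"
    for p :: "((nat \<Rightarrow> int) \<Rightarrow> nat \<Rightarrow> int) \<times> nat" and i
  have "real_of_int (form x x) = (\<Sum>i<n. \<Sum>j<n. real_of_int (x i) * (gram i j * x j))"
    by (simp add: form_def pair_def sum_distrib_left)
  also have "\<dots> = (\<Sum>i<n. \<Sum>j<n. 2 * (\<Sum>p\<in>ops \<times> {..<n}. T p i * T p j))"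
    by (intro sum.cong HOL.refl)
      (simp add: T_def entry avg_def sum_distrib_left sum_distrib_right mult_ac sum_divide_distrib)
  also have "\<dots> = 2 * (\<Sum>i<n. \<Sum>j<n. \<Sum>p\<in>ops \<times> {..<n}. T p i * T p j)"
    by (simp add: sum_distrib_left)
  also have "(\<Sum>i<n. \<Sum>j<n. \<Sum>p\<in>ops \<times> {..<n}. T p i * T p j) =
      (\<Sum>i<n. \<Sum>p\<in>ops \<times> {..<n}. \<Sum>j<n. T p i * T p j)"
    by (intro sum.cong HOL.refl sum.swap)
  also have "\<dots> = (\<Sum>p\<in>ops \<times> {..<n}. \<Sum>i<n. \<Sum>j<n. T p i * T p j)"
    by (rule sum.swap)
  finally show ?thesis by (simp add: power2_eq_square sum_product T_def)
qed

lemma form_nonneg: "spherical n m \<Longrightarrow> 0 \<le> form x x"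
proof -
  assume "spherical n m"
  then have "0 \<le> real_of_int (form x x)"
    by (simp add: form_scaled_sum_squares sum_nonneg)
  then show ?thesis by simp
qed

lemma form_definite:
  assumes sph: "spherical n m" and zero: "form x x = 0" and k: "k < n"
  shows "x k = 0"
proof -
  let ?s = "\<lambda>i. sqrt (avg (unit_fun i) (unit_fun i))"
  let ?f = "\<lambda>p. (\<Sum>i<n. real_of_int (x i) / ?s i * real_of_int (fst p (unit_fun i) (snd p)))\<^sup>2"
  have "sum ?f (ops \<times> {..<n}) = 0" using form_scaled_sum_squares[OF sph, of x] zero by simp
  \<comment> \<open>Every square vanishes; the one for the identity operator at coordinate
    \<open>k\<close> isolates \<open>x k\<close>.\<close>
  then have "?f (\<lambda>x. x, k) = 0"
    using sum_nonneg_eq_0_iff[of "ops \<times> {..<n}" ?f] finite_ops[OF sph] id_ops k by auto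
  moreover have "(\<Sum>i<n. x i / ?s i * unit_fun i k) = x k / ?s k"
    using k by (simp add: unit_fun_def if_distrib cong: if_cong)
  ultimately show ?thesis using avg_unit_pos[OF sph k] by simp
qed

text \<open>With label \<infinity> the sum of the two roots would have norm 2 - 4 + 2 = 0, against
  definiteness.\<close>

lemma spherical_finite_labels:
  assumes sph: "spherical n m" and ij: "i < n" "j < n"
  shows "m i j \<noteq> \<infinity>"
proof
  assume inf: "m i j = \<infinity>"
  then have ne: "i \<noteq> j" using m_diag[of i] ij by (auto simp: one_enat_def)
  then have "gram i j = - 2" "gram j i = - 2"
    using inf m_sym[OF ij] by (auto simp: gram_def numeral_eq_enat)
  then have "form (\<lambda>k. unit_fun i k - (- 1) * unit_fun j k)
      (\<lambda>k. unit_fun i k - (- 1) * unit_fun j k) = 0"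
    by (simp only: form_diff_left form_diff_right form_unit pair_unit gram_diag ij) simp
  from form_definite[OF sph this ij(1)] show False using ne by (simp add: unit_fun_def)
qed

section \<open>Central elements and the action modulo two\<close>

text \<open>This upgrades agreement on the coordinates below \<open>n\<close> to equality of
  functions.\<close>

lemma act_outside: "set xs \<subseteq> {..<n} \<Longrightarrow> n \<le> k \<Longrightarrow> act xs x k = x k"
  by (induction xs) (auto simp: refl_apply)

text \<open>If \<open>b = e\<^sub>i + 2 g\<close> is the image of \<open>e\<^sub>i\<close>, then \<open>form g g\<close> is even and
  \<open>form (e\<^sub>i + g) (e\<^sub>i + g) = 2 - form g g\<close>, so one of \<open>g\<close> and \<open>e\<^sub>i + g\<close> vanishes.\<close>

lemma act_unit_sign:
  assumes sph: "spherical n m" and xs: "set xs \<subseteq> {..<n}" and i: "i < n"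
    and even: "\<And>k. k < n \<Longrightarrow> even (act xs (unit_fun i) k - unit_fun i k)"
  shows "\<exists>c\<in>{1, - 1}. act xs (unit_fun i) = (\<lambda>k. c * unit_fun i k)"
proof -
  define e where "e = unit_fun i"
  define g where "g k = (act xs e k - e k) div 2" for k
  have b: "act xs e = (\<lambda>k. e k - (- 2) * g k)"
  proof
    fix k
    have "even (act xs e k - e k)"
      using even[of k] act_outside[OF xs, of k e] by (cases "k < n") (auto simp: e_def)
    then show "act xs e k = e k - (- 2) * g k" by (simp add: g_def)
  qed
  have ee: "form e e = 2" using i by (simp add: e_def)
  \<comment> \<open>Invariance of the norm of \<open>e\<close> determines
    \<open>form e g\<close>.\<close>
  have "form (act xs e) (act xs e) = form e e + 4 * form e g + 4 * form g g"
    unfolding b by (simp only: form_diff_left form_diff_right form_sym[of g e]) simp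
  then have eg: "form e g = - form g g" using form_act[OF xs] by simp
  have "form (\<lambda>k. e k - (- 1) * g k) (\<lambda>k. e k - (- 1) * g k) = form e e + 2 * form e g + form g g"
    by (simp only: form_diff_left form_diff_right form_sym[of g e]) simp
  then have h: "form (\<lambda>k. e k - (- 1) * g k) (\<lambda>k. e k - (- 1) * g k) = 2 - form g g"
    using ee eg by simp
  have "0 \<le> form g g" "form g g \<le> 2"
    using form_nonneg[OF sph, of g] form_nonneg[OF sph, of "\<lambda>k. e k - (- 1) * g k"] h by simp_all
  moreover have "form g g \<noteq> 1" using even_form[of g] by auto
  ultimately consider "form g g = 0" | "form g g = 2" by linarith
  then show ?thesis
  proof cases
    case 1
    have "act xs e k = 1 * e k" for k
      using form_definite[OF sph 1, of k] b act_outside[OF xs, of k e] by (cases "k < n") auto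
    then show ?thesis by (auto simp: e_def)
  next
    case 2
    have "act xs e k = (- 1) * e k" for k
      using form_definite[OF sph h[unfolded 2, simplified], of k] b act_outside[OF xs, of k e] i
      by (cases "k < n") (auto simp: e_def unit_fun_def)
    then show ?thesis by (auto simp: e_def)
  qed
qed

text \<open>Faithfulness is applied to \<open>xs @ rev ys\<close>, as reversal inverts a word in
  involutions.\<close>

lemma weq_iff_act:
  assumes sph: "spherical n m" and "set xs \<subseteq> {..<n}" "set ys \<subseteq> {..<n}"
  shows "weq xs ys \<longleftrightarrow> act xs = act ys"
proof
  assume eq: "act xs = act ys"
  have "act (xs @ rev ys) = act []"
    using weq_act[OF weq_rev[OF assms(3)]] eq by (simp add: fun_eq_iff)
  then have "weq (xs @ rev ys) []"
    using assms spherical_finite_labels by (intro act_faithful) auto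
  then have "weq ((xs @ rev ys) @ ys) ([] @ ys)"
    using assms by (intro weq_append weq_refl)
  moreover have "weq (xs @ []) (xs @ (rev ys @ ys))"
    using assms by (intro weq_append weq_refl weq_sym[OF weq_rev'])
  ultimately show "weq xs ys" using weq_trans[of xs "xs @ rev ys @ ys" ys] by simp
qed (rule weq_act)

lemma weq_commutes_iff_even:
  assumes sph: "spherical n m" and xs: "set xs \<subseteq> {..<n}"
  shows "(\<forall>i<n. weq (xs @ [i]) (i # xs)) \<longleftrightarrow>
    (\<forall>i<n. \<forall>k<n. even (act xs (unit_fun i) k - unit_fun i k))"
proof (intro iffI allI impI)
  fix i k assume comm: "\<forall>i<n. weq (xs @ [i]) (i # xs)" and i: "i < n" and k: "k < n"
  define v where "v = act xs (unit_fun i)"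
  have "act xs (refl i (unit_fun i)) = refl i v"
    using weq_act[of "xs @ [i]" "i # xs"] comm i by (simp add: fun_eq_iff v_def)
  moreover have "act xs (refl i (unit_fun i)) = (\<lambda>k. - v k)" using i by (simp add: act_refl v_def)
  \<comment> \<open>\<open>v\<close> is a -1 eigenvector of \<open>refl i\<close>, hence a multiple
    of the root \<open>i\<close>; comparing norms then leaves the factors 1 and -1.\<close>
  ultimately have 2: "2 * v k = pair i v * unit_fun i k" for k
    by (simp add: fun_eq_iff refl_def algebra_simps)
  have v: "v = (\<lambda>k. v i * unit_fun i k)"
  proof
    fix k show "v k = v i * unit_fun i k" using 2[of k] 2[of i]
      by (cases "k = i") (simp_all add: unit_fun_def)
  qed
  have "2 = form v v" using i form_act[OF xs, of "unit_fun i" "unit_fun i"] by (simp add: v_def)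
  also have "\<dots> = 2 * (v i)\<^sup>2"
    by (subst (1 2) v) (use i in \<open>simp add: form_scale power2_eq_square\<close>)
  finally have "(v i)\<^sup>2 = 1" by simp
  then have "v i = 1 \<or> v i = - 1" by (simp add: power2_eq_1_iff)
  then show "even (act xs (unit_fun i) k - unit_fun i k)"
    unfolding v_def[symmetric] by (subst v) (auto simp: unit_fun_def)
next
  fix i assume even: "\<forall>i<n. \<forall>k<n. even (act xs (unit_fun i) k - unit_fun i k)" and i: "i < n"
  have "\<exists>c\<in>{1, - 1}. act xs (unit_fun i) = (\<lambda>k. c * unit_fun i k)"
    using even i by (intro act_unit_sign[OF sph xs i]) blast
  then obtain c where "c \<in> {1, - 1}" and act: "act xs (unit_fun i) = (\<lambda>k. c * unit_fun i k)" ..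
  then have c: "c * c = 1" by auto
  \<comment> \<open>Invariance of the form moves the sign \<open>c\<close> into \<open>pair\<close>,
    where it meets the sign of the image of the root; the two cancel.\<close>
  have "act xs (refl i x) k = refl i (act xs x) k" for x k
  proof -
    have "pair i x = form (act xs (unit_fun i)) (act xs x)" using i form_act[OF xs] by simp
    also have "\<dots> = c * pair i (act xs x)"
      using i act by (simp add: form_scale)
    finally have "pair i x * c = (c * c) * pair i (act xs x)" by simp
    then have "pair i x * c = pair i (act xs x)" using c by simp
    then have "pair i x * (c * unit_fun i k) = pair i (act xs x) * unit_fun i k"
      by (metis mult.assoc)
    then show ?thesis unfolding act_refl act by (simp only: refl_def)
  qed
  then have "act (xs @ [i]) = act (i # xs)" by (intro ext) simp
  then show "weq (xs @ [i]) (i # xs)" using weq_iff_act[OF sph] xs i by simp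
qed

text \<open>Every group element has a positive word, and its letters can be moved past
  \<open>xs\<close> one at a time.\<close>

lemma center_iff_commutes:
  assumes xs: "set xs \<subseteq> {..<n}"
  shows "pres_rel {..<n} (coxeter_relations n m) `` {positive_word xs} \<in> center (coxeter_group n m) \<longleftrightarrow>
    (\<forall>i<n. weq (xs @ [i]) (i # xs))"
proof -
  let ?c = "\<lambda>u. pres_rel {..<n} (coxeter_relations n m) `` {u}" and ?W = "coxeter_group n m"
  have mult: "?c (positive_word xs) \<otimes>\<^bsub>?W\<^esub> ?c (positive_word ys) = ?c (positive_word (xs @ ys))"
    if "set xs \<subseteq> {..<n}" "set ys \<subseteq> {..<n}" for xs ys
    using that by (simp add: coxeter_group_def pres_group_mult)
  have eq: "?c (positive_word xs) = ?c (positive_word ys) \<longleftrightarrow> weq xs ys"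
    if "set xs \<subseteq> {..<n}" "set ys \<subseteq> {..<n}" for xs ys
    unfolding weq_def using that by (intro pres_class_eq_iff) simp_all
  have car: "?c (positive_word xs) \<in> carrier ?W" if "set xs \<subseteq> {..<n}" for xs
    using that by (simp add: coxeter_group_def pres_class_carrier)
  have repr: "\<exists>ys. set ys \<subseteq> {..<n} \<and> X = ?c (positive_word ys)" if X: "X \<in> carrier ?W" for X
  proof -
    obtain u where u: "u \<in> gwords {..<n}" "X = ?c u"
      using X unfolding coxeter_group_def by (rule pres_group_carrierE)
    have p: "pres_eq {..<n} (coxeter_relations n m) u (positive_word (map fst u))"
      using u(1) by (rule pres_eq_positive)
    then have "positive_word (map fst u) \<in> gwords {..<n}" using pres_eq_gwords by blast
    then have "set (map fst u) \<subseteq> {..<n}" "X = ?c (positive_word (map fst u))"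
      using pres_class_eq_iff[OF u(1)] p u(2) by simp_all
    then show ?thesis by blast
  qed
  have "weq (xs @ ys) (ys @ xs)" if comm: "\<forall>i<n. weq (xs @ [i]) (i # xs)" and "set ys \<subseteq> {..<n}" for ys
    using that(2)
  proof (induction ys)
    case Nil
    then show ?case using xs by (simp add: weq_refl)
  next
    case (Cons i ys)
    have "weq ((xs @ [i]) @ ys) ((i # xs) @ ys)"
      using comm Cons.prems by (intro weq_append weq_refl) auto
    moreover have "weq ([i] @ (xs @ ys)) ([i] @ (ys @ xs))"
      using weq_append[OF weq_refl[of "[i]"] Cons.IH] Cons.prems by simp
    ultimately show ?case using weq_trans[of "xs @ i # ys" "i # xs @ ys"] by simp
  qed
  moreover have "\<forall>i<n. weq (xs @ [i]) (i # xs)"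
    if "\<forall>ys. set ys \<subseteq> {..<n} \<longrightarrow> weq (xs @ ys) (ys @ xs)"
  proof (intro allI impI)
    fix i assume "i < n"
    then show "weq (xs @ [i]) (i # xs)" using that[rule_format, of "[i]"] by simp
  qed
  ultimately have "(\<forall>i<n. weq (xs @ [i]) (i # xs)) \<longleftrightarrow>
      (\<forall>ys. set ys \<subseteq> {..<n} \<longrightarrow> weq (xs @ ys) (ys @ xs))"
    by blast
  also have "\<dots> \<longleftrightarrow> (\<forall>ys. set ys \<subseteq> {..<n} \<longrightarrow>
      ?c (positive_word xs) \<otimes>\<^bsub>?W\<^esub> ?c (positive_word ys) =
      ?c (positive_word ys) \<otimes>\<^bsub>?W\<^esub> ?c (positive_word xs))"
    by (intro all_cong1 imp_cong HOL.refl) (simp only: mult eq xs set_append Un_subset_iff simp_thms)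
  also have "\<dots> \<longleftrightarrow> ?c (positive_word xs) \<in> center ?W"
    unfolding center_def using car[OF xs] car repr by blast
  finally show ?thesis by simp
qed

section \<open>Comparison with the Burau representation\<close>

text \<open>Off the diagonal the two entries agree up to sign; on it they are 0 and 2.\<close>

lemma bracket_int_parity:
  assumes "i < n" "j < n"
  shows "even (bracket_int m i j - gram i j)"
proof (cases "i = j")
  case False
  have "\<lfloor>- 1 :: real\<rfloor> = - 1" "\<lfloor>- 2 :: real\<rfloor> = - 2" by linarith+
  then show ?thesis
    using m_cases[OF assms False] False
    by (auto simp: bracket_int_def bracket_def gram_def numeral_eq_enat cos_60)
qed simp

text \<open>The inverse of a transvection negates its functional, which changes nothing modulo two,
  so both signs of a letter are treated alike.\<close>

lemma burau_letter:
  assumes "x < n"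
  obtains g where "letter_value (GL TYPE(int) n) (burau_mat n m) (x, b) = transvection n x g"
    "\<And>j. j < n \<Longrightarrow> even (g j - gram x j)"
proof (cases b)
  case True
  then show thesis
    using that[of "bracket_int m x"] bracket_int_parity[OF assms]
    by (simp add: letter_value_def burau_mat_transvection)
next
  case False
  interpret GL: group "GL TYPE(int) n" by (rule group_GL)
  let ?A = "transvection n x (bracket_int m x)" and ?B = "transvection n x (\<lambda>j. - bracket_int m x j)"
  have "?A * ?B = 1\<^sub>m n" "?B * ?A = 1\<^sub>m n"
    by (rule eq_matI; use assms in \<open>auto simp: transvection_mult2_index simp del: index_mult_mat(1)\<close>)+
  moreover have "?A \<in> carrier_mat n n" "?B \<in> carrier_mat n n" by (simp_all add: transvection_def)
  ultimately have "inv\<^bsub>GL TYPE(int) n\<^esub> ?A = ?B"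
    by (intro GL.inv_equality) (auto simp: GL_simps)
  moreover have "even (- bracket_int m x j - gram x j)" if "j < n" for j
    using bracket_int_parity[OF assms that] by simp
  ultimately show thesis
    using that[of "\<lambda>j. - bracket_int m x j"] False
    by (simp add: letter_value_def burau_mat_transvection)
qed

text \<open>Column \<open>l\<close> of the matrix is the image of the \<open>l\<close>-th basis
  vector; by induction on the word, each letter acts modulo two as the reflection does.\<close>

lemma burau_word_parity:
  assumes "u \<in> gwords {..<n}" "k < n" "l < n"
  shows "even (word_value (GL TYPE(int) n) (burau_mat n m) u $$ (k, l) - act (map fst u) (unit_fun l) k)"
  using assms(1,2)
proof (induction u arbitrary: k)
  case Nil
  then show ?case using assms(3) by (simp add: GL_simps unit_fun_def)
next
  case (Cons a u)
  obtain x b where a: "a = (x, b)" by (cases a)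
  have x: "x < n" and u: "u \<in> gwords {..<n}" using Cons.prems a by auto
  let ?M = "word_value (GL TYPE(int) n) (burau_mat n m) u" and ?v = "act (map fst u) (unit_fun l)"
  obtain g where g: "letter_value (GL TYPE(int) n) (burau_mat n m) (x, b) = transvection n x g"
    "\<And>j. j < n \<Longrightarrow> even (g j - gram x j)"
    using burau_letter[OF x] by blast
  have "?M \<in> carrier (GL TYPE(int) n)"
    using u by (intro word_value_closed[OF group_GL]) (auto intro: burau_mat_GL)
  then have "?M \<in> carrier_mat n n" by (simp add: GL_simps)
  then have "word_value (GL TYPE(int) n) (burau_mat n m) (a # u) $$ (k, l) =
      ?M $$ (k, l) - (if k = x then (\<Sum>t<n. g t * ?M $$ (t, l)) else 0)"
    using Cons.prems(2) assms(3) by (simp only: word_value.simps a g GL_simps transvection_mult_index)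
  moreover have "even ((\<Sum>t<n. g t * ?M $$ (t, l)) - pair x ?v)"
  proof -
    have "even (g t * ?M $$ (t, l) - gram x t * ?v t)" if "t < n" for t
      using g(2)[OF that] Cons.IH[OF u that] by auto
    then show ?thesis unfolding pair_def sum_subtractf[symmetric] by (intro dvd_sum) auto
  qed
  ultimately show ?case
    using Cons.IH[OF u Cons.prems(2)] a by (auto simp: refl_apply)
qed

end

section \<open>Reduction modulo two and comparison of the kernels\<close>

lemma of_int_bit_eq_iff: "(of_int a :: bit) = of_int b \<longleftrightarrow> even (a - b)"
proof -
  have "(of_int c :: bit) = 0 \<longleftrightarrow> even c" for c
    by (cases c rule: parity_cases) (auto elim!: evenE oddE)
  then have "(of_int (a - b) :: bit) = 0 \<longleftrightarrow> even (a - b)" .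
  then show ?thesis by (simp only: of_int_diff right_minus_eq)
qed

lemma reduce_mod2_eq_one_iff:
  assumes "A \<in> carrier_mat n n"
  shows "reduce_mod2 A = 1\<^sub>m n \<longleftrightarrow>
    (\<forall>k<n. \<forall>l<n. even (A $$ (k, l) - unit_fun l k))"
proof -
  have "(of_int (A $$ (k, l)) :: bit) = 1\<^sub>m n $$ (k, l) \<longleftrightarrow> even (A $$ (k, l) - unit_fun l k)"
    if "k < n" "l < n" for k l
    using of_int_bit_eq_iff[of "A $$ (k, l)" "unit_fun l k"] that by (auto simp: unit_fun_def)
  then show ?thesis using assms by (auto simp: mat_eq_iff reduce_mod2_def)
qed

theorem theorem6p7:
  fixes n :: nat and m :: "nat \<Rightarrow> nat \<Rightarrow> enat"
  assumes "coxeter_matrix n m"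
    and "small n m"
    and "spherical n m"
  shows "artin_level2 n m =
    kernel (artin_group n m) (coxeter_group n m Mod center (coxeter_group n m))
      (\<lambda>x. center (coxeter_group n m) #>\<^bsub>coxeter_group n m\<^esub> artin_proj n m x)"
proof -
  interpret small_coxeter n m using assms by unfold_locales
  let ?W = "coxeter_group n m" and ?Z = "center (coxeter_group n m)"
  interpret W: group ?W unfolding coxeter_group_def by (rule group_pres_group)
  have Z: "subgroup ?Z ?W" using center_normal[OF W.group_axioms] by (rule normal_imp_subgroup)
  \<comment> \<open>Both kernels are subsets of the Artin group, so membership is compared for one
    element at a time; the identity of the quotient group is the coset \<open>?Z\<close>.\<close>
  have "reduce_mod2 (burau_rep n m X) = 1\<^sub>m n \<longleftrightarrow> ?Z #>\<^bsub>?W\<^esub> artin_proj n m X = ?Z"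
    if X: "X \<in> carrier (artin_group n m)" for X
  proof -
    obtain u where u: "u \<in> gwords {..<n}" and Xu: "X = pres_rel {..<n} (artin_relations n m) `` {u}"
      using X unfolding artin_group_def by (rule pres_group_carrierE)
    let ?xs = "map fst u" and ?M = "word_value (GL TYPE(int) n) (burau_mat n m) u"
    have xs: "set ?xs \<subseteq> {..<n}"
      using pres_eq_gwords[OF pres_eq_positive[OF u]] by simp
    have "burau_rep n m X = ?M"
      unfolding burau_rep_def Xu using assms u
      by (intro pres_lift_class group_GL burau_mat_relations) (auto intro: burau_mat_GL)
    moreover have "?M \<in> carrier_mat n n"
      using word_value_closed[OF group_GL _ u, of "burau_mat n m"] burau_mat_GL
      by (simp add: GL_simps)
    ultimately have "reduce_mod2 (burau_rep n m X) = 1\<^sub>m n \<longleftrightarrow>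
        (\<forall>k<n. \<forall>l<n. even (?M $$ (k, l) - unit_fun l k))"
      by (simp add: reduce_mod2_eq_one_iff)
    also have "\<dots> \<longleftrightarrow> (\<forall>l<n. \<forall>k<n. even (act ?xs (unit_fun l) k - unit_fun l k))"
    proof -
      have "even (?M $$ (k, l) - unit_fun l k) \<longleftrightarrow> even (act ?xs (unit_fun l) k - unit_fun l k)"
        if "k < n" "l < n" for k l
        using burau_word_parity[OF u that] by auto
      then show ?thesis by auto
    qed
    also have "\<dots> \<longleftrightarrow> pres_rel {..<n} (coxeter_relations n m) `` {positive_word ?xs} \<in> ?Z"
      using weq_commutes_iff_even[OF assms(3) xs] center_iff_commutes[OF xs] by simp
    also have "pres_rel {..<n} (coxeter_relations n m) `` {positive_word ?xs} = artin_proj n m X"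
    proof -
      have "artin_proj n m X = word_value ?W (coxeter_gen n m) u"
        unfolding artin_proj_def Xu using assms u
        by (intro pres_lift_class coxeter_gen_relations)
          (auto simp: coxeter_gen_def coxeter_group_def pres_gen_def
            intro: group_pres_group pres_class_carrier)
      also have "\<dots> = pres_rel {..<n} (coxeter_relations n m) `` {u}"
        unfolding coxeter_group_def coxeter_gen_def using u by (rule word_value_pres_gen)
      also have "\<dots> = pres_rel {..<n} (coxeter_relations n m) `` {positive_word ?xs}"
        using pres_eq_positive[OF u] u xs by (subst pres_class_eq_iff) simp_all
      finally show ?thesis by (rule HOL.sym)
    qed
    also have "artin_proj n m X \<in> ?Z \<longleftrightarrow> ?Z #>\<^bsub>?W\<^esub> artin_proj n m X = ?Z"
      using W.coset_join1[OF _ _ Z] W.coset_join2[OF _ Z]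
        hom_in_carrier[OF artin_proj_hom[OF assms(1)] X] by blast
    finally show ?thesis .
  qed
  then show ?thesis
    by (auto simp: artin_level2_def kernel_def FactGroup_def GL_simps)
qed

end
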